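(* Let $B \subset \mathbb{C}$ be a horizontal strip of height at least $\pi$, let $p$ be a holomorphic function on $B$, and consider the Hill's operator \[ \mathcal{H} = \left(\frac{d}{dz}\right)^2 - \left(\frac{1}{4} + \frac{p}{2}\right) \] on $B$. Let $\ell$ be the function on $B$ that gives the (Euclidean) distance to the edge of $B$. Suppose that for some $M \in (0, \tfrac{1}{3})$, at every point of $B$, \[ \left|\frac{p}{2}\right| < \begin{cases} M\left(\frac{1}{2 \sin \ell}\right)^2 & \ell \le \frac{\pi}{2} \\ M\frac{1}{4} & \ell \ge \frac{\pi}{2}. \end{cases} \] Let $y : B \to \mathbb{C}$ be any conformal map such that (1) $y$ extends to a topological embedding $\hat{B} \to \hat{\mathbb{C}}$ (also denoted $y$) which fixes $-\infty$ and $+\infty$, and (2) $\mathcal{H} = y_z^{3/2} \circ \left[ \left(\frac{d}{dy}\right)^2 - \frac{1}{4} \right] \circ y_z^{1/2}$. Then for any two points $\mathfrak{m}, \mathfrak{n} \in \hat{B} \smallsetminus \{\pm\infty\}$, the displacements $r = z(\mathfrak{n}) - z(\mathfrak{m})$ and $r' = y(\mathfrak{n}) - y(\mathfrak{m})$ satisfy \[ |r' - r| \le \tfrac{2M}{1-M}\left(|\Re r| + \tfrac{3}{2}j\pi\right) \] for every $j \in \{1, 2, 3, \ldots\}$ with $|\Im r| \in [0, j\pi]$.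
   Context: The doubly extended plane $\hat{\mathbb{C}}$ is the set $\mathbb{C} \cup \{-\infty, +\infty\}$, topologized so that $\mathbb{C}$ is an open subset with its usual topology, the sets $\{-\infty\} \cup \{z \in \mathbb{C} : \Re z < c\}$, $c \in \mathbb{R}$, form a neighborhood basis of $-\infty$, and the sets $\{+\infty\} \cup \{z \in \mathbb{C} : \Re z > c\}$, $c \in \mathbb{R}$, form a neighborhood basis of $+\infty$. For a horizontal strip $B \subset \mathbb{C}$ (an open set), $\hat{B}$ denotes the closure of $B$ in $\hat{\mathbb{C}}$; it comprises the strip $B$, the edges of the strip, and the points $-\infty$ and $+\infty$. A conformal map is a holomorphic map with nowhere vanishing derivative. Here $z$ is the standard coordinate on $\mathbb{C}$, $y_z = dy/dz$, and $\frac{d}{dy} = \frac{1}{y_z}\frac{d}{dz}$. The symbol $y_z^{1/2}$ denotes a holomorphic square root of $y_z$ on $B$, and $y_z^{3/2} = (y_z^{1/2})^3$; functions appearing in compositions of operators act by multiplication. The equality in (2) is an equality of differential operators acting on holomorphic functions on (open subsets of) $B$. Since the extension of $y$ is injective and fixes $\pm\infty$, it sends $\hat{B} \smallsetminus \{\pm\infty\}$ into $\mathbb{C}$, so $r'$ is a complex number. *)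

theory Defs
  imports "HOL-Complex_Analysis.Complex_Analysis"
begin

section \<open>The doubly extended plane\<close>

datatype dbl_ext = MInf | PInf | Fin (coord: complex)

text \<open>
  The selector \<^const>\<open>coord\<close> is the standard coordinate; it carries no meaning at the two
  points at infinity.
\<close>

instantiation dbl_ext :: topological_space
begin

definition open_dbl_ext :: "dbl_ext set \<Rightarrow> bool" where
  "open_dbl_ext U \<longleftrightarrow> open (Fin -` U)
     \<and> (MInf \<in> U \<longrightarrow> (\<exists>c. Fin ` {z. Re z < c} \<subseteq> U))
     \<and> (PInf \<in> U \<longrightarrow> (\<exists>c. Fin ` {z. Re z > c} \<subseteq> U))"

instance
proof
  show "open (UNIV :: dbl_ext set)"
    by (simp add: open_dbl_ext_def)
next
  fix S T :: "dbl_ext set"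
  assume S: "open S" and T: "open T"
  have "\<exists>c. Fin ` {z. Re z < c} \<subseteq> S \<inter> T" if m: "MInf \<in> S \<inter> T"
  proof -
    have "\<exists>c. Fin ` {z. Re z < c} \<subseteq> S" "\<exists>c. Fin ` {z. Re z < c} \<subseteq> T"
      using S T m by (simp_all add: open_dbl_ext_def)
    then obtain c d where "Fin ` {z. Re z < c} \<subseteq> S" "Fin ` {z. Re z < d} \<subseteq> T"
      by (elim exE)
    then have "Fin ` {z. Re z < min c d} \<subseteq> S \<inter> T" by auto
    then show ?thesis by blast
  qed
  moreover have "\<exists>c. Fin ` {z. Re z > c} \<subseteq> S \<inter> T" if m: "PInf \<in> S \<inter> T"
  proof -
    have "\<exists>c. Fin ` {z. Re z > c} \<subseteq> S" "\<exists>c. Fin ` {z. Re z > c} \<subseteq> T"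
      using S T m by (simp_all add: open_dbl_ext_def)
    then obtain c d where "Fin ` {z. Re z > c} \<subseteq> S" "Fin ` {z. Re z > d} \<subseteq> T"
      by (elim exE)
    then have "Fin ` {z. Re z > max c d} \<subseteq> S \<inter> T" by auto
    then show ?thesis by blast
  qed
  ultimately show "open (S \<inter> T)"
    using S T unfolding open_dbl_ext_def by (simp add: vimage_Int open_Int)
next
  fix K :: "dbl_ext set set"
  assume K: "\<forall>S\<in>K. open S"
  have "open (Fin -` S)" if "S \<in> K" for S
    using K that by (simp add: open_dbl_ext_def)
  then have "open (Fin -` \<Union>K)"
    unfolding vimage_Union by (intro open_UN) simp
  moreover have "\<exists>c. Fin ` {z. Re z < c} \<subseteq> \<Union>K" if m: "MInf \<in> \<Union>K"
  proof -
    obtain S where S: "S \<in> K" "MInf \<in> S" using m by (rule UnionE)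
    then have "\<exists>c. Fin ` {z. Re z < c} \<subseteq> S" using K by (simp add: open_dbl_ext_def)
    then obtain c where "Fin ` {z. Re z < c} \<subseteq> S" ..
    with S(1) show ?thesis by blast
  qed
  moreover have "\<exists>c. Fin ` {z. Re z > c} \<subseteq> \<Union>K" if m: "PInf \<in> \<Union>K"
  proof -
    obtain S where S: "S \<in> K" "PInf \<in> S" using m by (rule UnionE)
    then have "\<exists>c. Fin ` {z. Re z > c} \<subseteq> S" using K by (simp add: open_dbl_ext_def)
    then obtain c where "Fin ` {z. Re z > c} \<subseteq> S" ..
    with S(1) show ?thesis by blast
  qed
  ultimately show "open (\<Union>K)"
    by (simp add: open_dbl_ext_def)
qed

end

lemma open_Fin_image_iff: "open (Fin ` S) \<longleftrightarrow> open S"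
proof -
  have "Fin -` Fin ` S = S" by auto
  then show ?thesis by (auto simp: open_dbl_ext_def)
qed

lemma open_MInf_basis: "open (insert MInf (Fin ` {z. Re z < c}))"
proof -
  have "Fin -` insert MInf (Fin ` {z. Re z < c}) = {z. Re z < c}" by auto
  then show ?thesis by (auto simp: open_dbl_ext_def open_halfspace_Re_lt)
qed

lemma open_PInf_basis: "open (insert PInf (Fin ` {z. Re z > c}))"
proof -
  have "Fin -` insert PInf (Fin ` {z. Re z > c}) = {z. Re z > c}" by auto
  then show ?thesis by (auto simp: open_dbl_ext_def open_halfspace_Re_gt)
qed

lemma nhd_MInf_iff:
  "(\<exists>U. open U \<and> MInf \<in> U \<and> U \<subseteq> N) \<longleftrightarrow> (\<exists>c. insert MInf (Fin ` {z. Re z < c}) \<subseteq> N)"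
proof
  assume "\<exists>U. open U \<and> MInf \<in> U \<and> U \<subseteq> N"
  then obtain U where U: "open U" "MInf \<in> U" "U \<subseteq> N" by (elim exE conjE)
  then have "\<exists>c. Fin ` {z. Re z < c} \<subseteq> U" by (simp add: open_dbl_ext_def)
  then obtain c where "Fin ` {z. Re z < c} \<subseteq> U" ..
  with U have "insert MInf (Fin ` {z. Re z < c}) \<subseteq> N" by blast
  then show "\<exists>c. insert MInf (Fin ` {z. Re z < c}) \<subseteq> N" ..
next
  assume "\<exists>c. insert MInf (Fin ` {z. Re z < c}) \<subseteq> N"
  then obtain c where "insert MInf (Fin ` {z. Re z < c}) \<subseteq> N" ..
  then show "\<exists>U. open U \<and> MInf \<in> U \<and> U \<subseteq> N"
    using open_MInf_basis[of c] by (intro exI[of _ "insert MInf (Fin ` {z. Re z < c})"]) simp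
qed

lemma nhd_PInf_iff:
  "(\<exists>U. open U \<and> PInf \<in> U \<and> U \<subseteq> N) \<longleftrightarrow> (\<exists>c. insert PInf (Fin ` {z. Re z > c}) \<subseteq> N)"
proof
  assume "\<exists>U. open U \<and> PInf \<in> U \<and> U \<subseteq> N"
  then obtain U where U: "open U" "PInf \<in> U" "U \<subseteq> N" by (elim exE conjE)
  then have "\<exists>c. Fin ` {z. Re z > c} \<subseteq> U" by (simp add: open_dbl_ext_def)
  then obtain c where "Fin ` {z. Re z > c} \<subseteq> U" ..
  with U have "insert PInf (Fin ` {z. Re z > c}) \<subseteq> N" by blast
  then show "\<exists>c. insert PInf (Fin ` {z. Re z > c}) \<subseteq> N" ..
next
  assume "\<exists>c. insert PInf (Fin ` {z. Re z > c}) \<subseteq> N"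
  then obtain c where "insert PInf (Fin ` {z. Re z > c}) \<subseteq> N" ..
  then show "\<exists>U. open U \<and> PInf \<in> U \<and> U \<subseteq> N"
    using open_PInf_basis[of c] by (intro exI[of _ "insert PInf (Fin ` {z. Re z > c})"]) simp
qed


section \<open>Horizontal strips\<close>

definition horizontal_strip :: "real \<Rightarrow> real \<Rightarrow> complex set" where
  "horizontal_strip a b = {z. a < Im z \<and> Im z < b}"

definition ext_closure :: "complex set \<Rightarrow> dbl_ext set" where
  "ext_closure B = closure (Fin ` B)"

lemma ext_closure_horizontal_strip:
  assumes "a < b"
  shows "ext_closure (horizontal_strip a b)
    = insert MInf (insert PInf (Fin ` {z. a \<le> Im z \<and> Im z \<le> b}))" (is "_ = ?R")
proof
  have "- ?R = Fin ` ({z. Im z < a} \<union> {z. Im z > b})"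
  proof (rule set_eqI)
    fix w show "w \<in> - ?R \<longleftrightarrow> w \<in> Fin ` ({z. Im z < a} \<union> {z. Im z > b})"
      by (cases w) (auto simp: image_iff not_le)
  qed
  then have "closed ?R"
    unfolding closed_def by (simp add: open_Fin_image_iff open_Un open_halfspace_Im_lt open_halfspace_Im_gt)
  then show "ext_closure (horizontal_strip a b) \<subseteq> ?R"
    unfolding ext_closure_def horizontal_strip_def by (intro closure_minimal) auto
next
  define m where "m = (a + b) / 2"
  have m: "a < m" "m < b" using assms by (auto simp: m_def)
  have "MInf \<in> closure (Fin ` horizontal_strip a b)"
    unfolding closure_iff_nhds_not_empty
  proof (intro allI impI)
    fix A V assume V: "V \<subseteq> A" "open V" "MInf \<in> V"
    have "\<exists>c. Fin ` {z. Re z < c} \<subseteq> V"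
      using V(2,3) by (simp add: open_dbl_ext_def)
    then obtain c where "Fin ` {z. Re z < c} \<subseteq> V" ..
    with V(1) have c: "Fin ` {z. Re z < c} \<subseteq> A" by (rule order_trans[rotated])
    have "Complex (c - 1) m \<in> {z. Re z < c}" by simp
    with c have "Fin (Complex (c - 1) m) \<in> A" by blast
    moreover have "Complex (c - 1) m \<in> horizontal_strip a b"
      using m by (simp add: horizontal_strip_def)
    ultimately show "Fin ` horizontal_strip a b \<inter> A \<noteq> {}" by blast
  qed
  moreover have "PInf \<in> closure (Fin ` horizontal_strip a b)"
    unfolding closure_iff_nhds_not_empty
  proof (intro allI impI)
    fix A V assume V: "V \<subseteq> A" "open V" "PInf \<in> V"
    have "\<exists>c. Fin ` {z. Re z > c} \<subseteq> V"
      using V(2,3) by (simp add: open_dbl_ext_def)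
    then obtain c where "Fin ` {z. Re z > c} \<subseteq> V" ..
    with V(1) have c: "Fin ` {z. Re z > c} \<subseteq> A" by (rule order_trans[rotated])
    have "Complex (c + 1) m \<in> {z. Re z > c}" by simp
    with c have "Fin (Complex (c + 1) m) \<in> A" by blast
    moreover have "Complex (c + 1) m \<in> horizontal_strip a b"
      using m by (simp add: horizontal_strip_def)
    ultimately show "Fin ` horizontal_strip a b \<inter> A \<noteq> {}" by blast
  qed
  moreover have "Fin z \<in> closure (Fin ` horizontal_strip a b)" if z: "a \<le> Im z" "Im z \<le> b" for z
    unfolding closure_iff_nhds_not_empty
  proof (intro allI impI)
    fix A V assume V: "V \<subseteq> A" "open V" "Fin z \<in> V"
    then have "open (Fin -` V)" "z \<in> Fin -` V"
      unfolding open_dbl_ext_def by auto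
    then obtain e where e: "e > 0" "ball z e \<subseteq> Fin -` V"
      using open_contains_ball by blast
    define t where "t = e / (e + (b - a))"
    have pos: "e + (b - a) > 0" "e > 0" "b - a > 0" using e(1) assms by auto
    have t: "0 < t" "t < 1"
      using pos by (simp_all add: t_def)
    have "t * (b - a) = e * ((b - a) / (e + (b - a)))" by (simp add: t_def)
    also have "\<dots> < e * 1"
      using pos by (intro mult_strict_left_mono) simp_all
    finally have te: "t * (b - a) < e" by simp
    define w where "w = Complex (Re z) (Im z + t * (m - Im z))"
    have "z - w = Complex 0 (- (t * (m - Im z)))"
      by (simp add: w_def complex_eq_iff)
    then have "dist z w = \<bar>t * (m - Im z)\<bar>"
      by (simp add: dist_norm cmod_def)
    also have "\<dots> \<le> t * (b - a)"
      using t m z by (auto simp: abs_mult intro!: mult_left_mono)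
    finally have "w \<in> ball z e" using te by simp
    then have "Fin w \<in> A" using e(2) V(1) by blast
    moreover have "w \<in> horizontal_strip a b"
    proof -
      have eq: "Im w = (1 - t) * Im z + t * m"
        by (simp add: w_def algebra_simps)
      have "(1 - t) * a + t * a < (1 - t) * Im z + t * m"
        using t m z by (intro add_le_less_mono mult_left_mono mult_strict_left_mono) auto
      moreover have "(1 - t) * Im z + t * m < (1 - t) * b + t * b"
        using t m z by (intro add_le_less_mono mult_left_mono mult_strict_left_mono) auto
      ultimately show ?thesis
        unfolding horizontal_strip_def eq mem_Collect_eq by (simp add: algebra_simps)
    qed
    ultimately show "Fin ` horizontal_strip a b \<inter> A \<noteq> {}"
      by blast
  qed
  ultimately show "?R \<subseteq> ext_closure (horizontal_strip a b)"
    unfolding ext_closure_def by auto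
qed

definition edge_dist :: "complex set \<Rightarrow> complex \<Rightarrow> real" where
  "edge_dist B z = infdist z (frontier B)"

definition conformal_map_on :: "(complex \<Rightarrow> complex) \<Rightarrow> complex set \<Rightarrow> bool" where
  "conformal_map_on y B \<longleftrightarrow> y holomorphic_on B \<and> (\<forall>z\<in>B. deriv y z \<noteq> 0)"


section \<open>Differential operators\<close>

type_synonym cop = "(complex \<Rightarrow> complex) \<Rightarrow> complex \<Rightarrow> complex"

definition mult_op :: "(complex \<Rightarrow> complex) \<Rightarrow> cop" where
  "mult_op g = (\<lambda>f z. g z * f z)"

definition ddy :: "(complex \<Rightarrow> complex) \<Rightarrow> cop" where
  "ddy y = mult_op (\<lambda>z. 1 / deriv y z) \<circ> deriv"

definition op_minus :: "cop \<Rightarrow> cop \<Rightarrow> cop" where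
  "op_minus P Q = (\<lambda>f z. P f z - Q f z)"

definition hill_op :: "(complex \<Rightarrow> complex) \<Rightarrow> cop" where
  "hill_op p = op_minus (deriv ^^ 2) (mult_op (\<lambda>z. 1 / 4 + p z / 2))"

text \<open>
  Equality of differential operators over \<open>B\<close>: agreement on all functions holomorphic on some
  open subset. Since \<^const>\<open>deriv\<close> is local, values outside \<open>U\<close> play no role.
\<close>

definition op_eq_on :: "complex set \<Rightarrow> cop \<Rightarrow> cop \<Rightarrow> bool" where
  "op_eq_on B P Q \<longleftrightarrow>
     (\<forall>U f. open U \<longrightarrow> U \<subseteq> B \<longrightarrow> f holomorphic_on U \<longrightarrow> (\<forall>z\<in>U. P f z = Q f z))"

end

theory Submission
  imports Defs "HOL-Real_Asymp.Real_Asymp"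
begin

text \<open>
  Write \<open>q = p / 2\<close>. By the conjugation formula, \<open>\<psi>\<^sub>\<plusminus> = exp (\<plusminus>y / 2) / y\<^sub>z\<^bsup>1/2\<^esup>\<close> solve
  \<open>\<psi>'' = (1/4 + q) \<psi>\<close>, so \<open>g\<^sub>\<plusminus> = \<plusminus>\<psi>\<^sub>\<plusminus>' / \<psi>\<^sub>\<plusminus> - 1/2\<close> satisfy the Riccati equations
  \<open>g' = \<plusminus>(q - g - g\<^sup>2)\<close>, while \<open>y\<^sub>z - 1 = g\<^sub>+ + g\<^sub>-\<close> and \<open>y\<^sub>z\<^sub>z / y\<^sub>z = g\<^sub>- - g\<^sub>+\<close>. Let \<open>k\<close> be the small root
  of \<open>k - k\<^sup>2 = M / 4\<close>. Along horizontal lines at distance at least \<open>\<pi> / 2\<close> from the edge, \<open>\<psi>\<^sub>\<plusminus>\<close> is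
  the recessive solution at \<open>\<mp>\<infinity>\<close>, because \<open>y\<close> fixes \<open>\<plusminus>\<infinity>\<close>; this forces \<open>|g\<^sub>\<plusminus>| \<le> k\<close>, hence
  \<open>|y\<^sub>z - 1| \<le> 2k\<close>. Going vertically from there to an edge, the linear term of the Riccati equation
  only rotates \<open>g\<close>, and comparison with a multiple of the tangent gives \<open>|g\<^sub>\<plusminus>| = O(k / sin l)\<close>. So
  \<open>log y\<^sub>z\<close> varies at most logarithmically in \<open>l\<close> and \<open>y\<^sub>z - 1\<close> is integrable up to the edge. Any two points
  are joined by two such vertical legs and a path in the middle.
\<close>

section \<open>Linear and Riccati equations on the line\<close>

text \<open>Stands in for integration along a path: \<open>\<phi>\<close> is taken to be an explicit
  antiderivative of the bound on the speed, so no integral has to be formed.\<close>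

lemma norm_diff_le_of_vector_derivative:
  fixes f :: "real \<Rightarrow> 'a::real_normed_vector" and \<phi> :: "real \<Rightarrow> real"
  assumes "s \<le> t"
    and f: "\<And>x. s \<le> x \<Longrightarrow> x \<le> t \<Longrightarrow> (f has_vector_derivative f' x) (at x)"
    and \<phi>: "\<And>x. s \<le> x \<Longrightarrow> x \<le> t \<Longrightarrow> (\<phi> has_real_derivative \<phi>' x) (at x)"
    and le: "\<And>x. s \<le> x \<Longrightarrow> x \<le> t \<Longrightarrow> norm (f' x) \<le> \<phi>' x"
  shows "norm (f t - f s) \<le> \<phi> t - \<phi> s"
proof (cases "s = t")
  case False
  with assms(1) have "s < t" by simp
  then show ?thesis
  proof (rule differentiable_bound_general[where f' = f' and \<phi>' = \<phi>'])
    show "continuous_on {s..t} f"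
      using f by (intro continuous_at_imp_continuous_on ballI) (auto dest: has_vector_derivative_continuous)
    show "continuous_on {s..t} \<phi>"
      using \<phi> by (intro continuous_at_imp_continuous_on ballI) (auto dest: DERIV_isCont)
  qed (use f \<phi> le in \<open>auto simp: has_real_derivative_iff_has_vector_derivative\<close>)
qed simp

lemma has_vector_derivative_quotient:
  fixes f g :: "real \<Rightarrow> complex"
  assumes f: "(f has_vector_derivative f') (at t)" and g: "(g has_vector_derivative g') (at t)"
    and nz: "g t \<noteq> 0"
  shows "((\<lambda>t. f t / g t) has_vector_derivative (f' * g t - f t * g') / (g t)\<^sup>2) (at t)"
proof -
  have "((\<lambda>t. inverse (g t)) has_vector_derivative g' * - (inverse (g t) * inverse (g t))) (at t)"
    using field_vector_diff_chain_at[OF g DERIV_inverse'[OF DERIV_ident nz]] by (simp add: o_def)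
  from has_vector_derivative_mult[OF f this] show ?thesis
    using nz by (simp add: field_simps power2_eq_square)
qed

text \<open>The integrating factor turns the equation into \<open>(exp t * f)' = exp t * h\<close>.
  Seen from time \<open>t\<close>, the value at \<open>s\<close> is damped by
  \<open>exp (s - t)\<close>; since \<open>f\<close> is bounded, letting \<open>s\<close> tend to
  -\<infinity> leaves only the forcing.\<close>

lemma bounded_solution_relaxation:
  fixes f h :: "real \<Rightarrow> complex"
  assumes f: "\<And>t. (f has_vector_derivative h t - f t) (at t)"
    and C: "\<And>t. norm (f t) \<le> C"
    and H: "\<And>t. norm (h t) \<le> H"
  shows "norm (f t) \<le> H"
proof (rule tendsto_lowerbound[where F = at_bot and f = "\<lambda>s. H + exp (s - t) * (C - H)"])
  show "((\<lambda>s. H + exp (s - t) * (C - H)) \<longlongrightarrow> H) at_bot"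
    by real_asymp
  show "\<forall>\<^sub>F s in at_bot. norm (f t) \<le> H + exp (s - t) * (C - H)"
    unfolding eventually_at_bot_linorder
  proof (intro exI allI impI)
    fix s assume s: "s \<le> t"
    have "norm (exp t *\<^sub>R f t - exp s *\<^sub>R f s) \<le> H * exp t - H * exp s"
    proof (rule norm_diff_le_of_vector_derivative[OF s])
      fix x :: real
      show "((\<lambda>x. exp x *\<^sub>R f x) has_vector_derivative exp x *\<^sub>R h x) (at x)"
        by (rule derivative_eq_intros f refl)+ (simp add: algebra_simps)
      show "((\<lambda>x. H * exp x) has_real_derivative H * exp x) (at x)"
        by (auto intro!: derivative_eq_intros)
      show "norm (exp x *\<^sub>R h x) \<le> H * exp x"
        using H[of x] by (simp add: mult.commute)
    qed
    moreover have "norm (exp t *\<^sub>R f t) \<le> norm (exp t *\<^sub>R f t - exp s *\<^sub>R f s) + norm (exp s *\<^sub>R f s)"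
      by (metis diff_add_cancel norm_triangle_ineq)
    moreover have "norm (exp s *\<^sub>R f s) \<le> exp s * C"
      using C[of s] by simp
    ultimately have "norm (exp t *\<^sub>R f t) \<le> H * exp t - H * exp s + exp s * C" by linarith
    then have "exp t * norm (f t) \<le> H * exp t - H * exp s + exp s * C" by simp
    also have "\<dots> = exp t * (H + exp (s - t) * (C - H))"
      by (simp add: exp_diff field_simps)
    finally show "norm (f t) \<le> H + exp (s - t) * (C - H)" by simp
  qed
qed simp

text \<open>
  On the line, the squared norms of solutions are convex, so a solution violating the conclusion
  grows at \<open>-\<infinity>\<close>, and \<open>\<phi>\<close> grows even faster. But \<open>(\<psi> / \<phi>)' = 1 / \<phi>\<^sup>2\<close>, which bounds
  \<open>\<psi> \<phi>\<close> near \<open>-\<infinity>\<close> once \<open>\<phi>\<close> grows exponentially.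
\<close>
lemma recessive_solution_increasing:
  fixes \<psi> \<psi>' \<phi> \<phi>' Q :: "real \<Rightarrow> complex"
  assumes \<psi>: "\<And>t. (\<psi> has_vector_derivative \<psi>' t) (at t)"
    and \<psi>': "\<And>t. (\<psi>' has_vector_derivative Q t * \<psi> t) (at t)"
    and \<phi>: "\<And>t. (\<phi> has_vector_derivative \<phi>' t) (at t)"
    and \<phi>': "\<And>t. (\<phi>' has_vector_derivative Q t * \<phi> t) (at t)"
    and Q: "\<And>t. Re (Q t) \<ge> 1 / 9"
    and wronskian: "\<And>t. \<psi>' t * \<phi> t - \<psi> t * \<phi>' t = 1"
    and nz: "\<And>t. \<phi> t \<noteq> 0"
    and lim: "((\<lambda>t. \<psi> t / \<phi> t) \<longlongrightarrow> 0) at_bot"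
  shows "\<psi> t \<bullet> \<psi>' t \<ge> 0"
proof (rule ccontr)
  have sq: "((\<lambda>t. (cmod (f t))\<^sup>2) has_real_derivative 2 * (f t \<bullet> f' t)) (at t)"
    if "\<And>t. (f has_vector_derivative f' t) (at t)" for f f' :: "real \<Rightarrow> complex" and t
    unfolding power2_norm_eq_inner has_real_derivative_iff_has_vector_derivative
    using bounded_bilinear.has_vector_derivative[OF bounded_bilinear_inner that that, of t]
    by (simp add: inner_commute)
  have inn: "((\<lambda>t. f t \<bullet> f' t) has_real_derivative (cmod (f' t))\<^sup>2 + Re (Q t) * (cmod (f t))\<^sup>2) (at t)"
    if "\<And>t. (f has_vector_derivative f' t) (at t)" "\<And>t. (f' has_vector_derivative Q t * f t) (at t)"
    for f f' :: "real \<Rightarrow> complex" and t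
    unfolding power2_norm_eq_inner has_real_derivative_iff_has_vector_derivative
    using bounded_bilinear.has_vector_derivative[OF bounded_bilinear_inner that, of t]
    by (simp add: inner_complex_def algebra_simps)
  \<comment> \<open>Arithmetic-geometric mean: the rate 2/3 is twice the square root of the lower
    bound 1/9 on \<open>Re (Q t)\<close>. The right-hand side is the derivative of
    \<open>f \<bullet> f'\<close> along a solution.\<close>
  have growth: "2 / 3 * \<bar>z \<bullet> w\<bar> \<le> (cmod w)\<^sup>2 + Re (Q t) * (cmod z)\<^sup>2" for z w t
  proof -
    have "2 / 3 * \<bar>z \<bullet> w\<bar> \<le> 2 / 3 * (cmod z * cmod w)"
      using Cauchy_Schwarz_ineq2[of z w] by simp
    also have "\<dots> \<le> (cmod w)\<^sup>2 + 1 / 9 * (cmod z)\<^sup>2"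
      using zero_le_power2[of "cmod w - cmod z / 3"] by (simp add: power2_eq_square field_simps)
    also have "\<dots> \<le> (cmod w)\<^sup>2 + Re (Q t) * (cmod z)\<^sup>2"
      using Q[of t] by (intro add_left_mono mult_right_mono) auto
    finally show ?thesis .
  qed
  have mono: "f s \<bullet> f' s \<le> f t \<bullet> f' t" if "s \<le> t"
    "\<And>t. (f has_vector_derivative f' t) (at t)" "\<And>t. (f' has_vector_derivative Q t * f t) (at t)"
    for f f' :: "real \<Rightarrow> complex" and s t
    by (rule DERIV_nonneg_imp_nondecreasing[OF that(1)])
      (use inn[OF that(2,3)] growth in \<open>meson abs_ge_zero order_trans zero_le_mult_iff
         divide_nonneg_nonneg zero_le_numeral\<close>)
  define h where "h t = (cmod (\<phi> t))\<^sup>2" for t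
  have h_pos: "h t > 0" for t using nz by (simp add: h_def)
  have h': "(h has_real_derivative 2 * (\<phi> t \<bullet> \<phi>' t)) (at t)" for t
    using sq[OF \<phi>] by (simp add: h_def[abs_def])
  assume "\<not> \<psi> t \<bullet> \<psi>' t \<ge> 0"
  then have neg: "\<psi> t \<bullet> \<psi>' t < 0" by simp
  \<comment> \<open>By \<open>mono\<close> the inner product stays below its negative value at
    \<open>t\<close> everywhere to the left, so the squared norm grows at least linearly towards
    -\<infinity>.\<close>
  have \<psi>_lower: "(cmod (\<psi> s))\<^sup>2 \<ge> -2 * (\<psi> t \<bullet> \<psi>' t) * (t - s)" if "s \<le> t" for s
  proof -
    have "(cmod (\<psi> t))\<^sup>2 - 2 * (\<psi> t \<bullet> \<psi>' t) * t \<le> (cmod (\<psi> s))\<^sup>2 - 2 * (\<psi> t \<bullet> \<psi>' t) * s"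
    proof (rule DERIV_nonpos_imp_nonincreasing[OF that], intro exI conjI)
      fix x assume x: "s \<le> x" "x \<le> t"
      show "((\<lambda>s. (cmod (\<psi> s))\<^sup>2 - 2 * (\<psi> t \<bullet> \<psi>' t) * s) has_real_derivative
          2 * (\<psi> x \<bullet> \<psi>' x) - 2 * (\<psi> t \<bullet> \<psi>' t)) (at x)"
        using DERIV_diff[OF sq[OF \<psi>, of x] DERIV_cmult[OF DERIV_ident, of "2 * (\<psi> t \<bullet> \<psi>' t)" x]]
        by simp
      show "2 * (\<psi> x \<bullet> \<psi>' x) - 2 * (\<psi> t \<bullet> \<psi>' t) \<le> 0"
        using mono[OF x(2) \<psi> \<psi>'] by simp
    qed
    then show ?thesis by (simp add: algebra_simps) (smt (verit) zero_le_power2)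
  qed
  have \<psi>_inf: "filterlim (\<lambda>s. (cmod (\<psi> s))\<^sup>2) at_top at_bot"
  proof (rule filterlim_at_top_mono)
    show "filterlim (\<lambda>s. -2 * (\<psi> t \<bullet> \<psi>' t) * (t - s)) at_top at_bot"
      using neg by real_asymp
    show "\<forall>\<^sub>F s in at_bot. -2 * (\<psi> t \<bullet> \<psi>' t) * (t - s) \<le> (cmod (\<psi> s))\<^sup>2"
      using \<psi>_lower unfolding eventually_at_bot_linorder by blast
  qed
  have ev_le: "\<forall>\<^sub>F s in at_bot. (cmod (\<psi> s))\<^sup>2 \<le> h s"
    using tendstoD[OF lim, of 1]
  proof (simp, elim eventually_mono)
    fix s assume "cmod (\<psi> s / \<phi> s) < 1"
    then have "cmod (\<psi> s) \<le> cmod (\<phi> s)" using nz[of s] by (simp add: norm_divide field_simps)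
    then show "(cmod (\<psi> s))\<^sup>2 \<le> h s" by (simp add: h_def power_mono)
  qed
  have h_inf: "filterlim h at_top at_bot"
    by (rule filterlim_at_top_mono[OF \<psi>_inf ev_le])
  have "\<exists>t1. \<phi> t1 \<bullet> \<phi>' t1 < 0"
  proof (rule ccontr)
    assume "\<nexists>t1. \<phi> t1 \<bullet> \<phi>' t1 < 0"
    then have nn: "\<phi> s \<bullet> \<phi>' s \<ge> 0" for s by (meson not_le)
    have "h s \<le> h 0" if "s \<le> 0" for s
      using DERIV_nonneg_imp_nondecreasing[OF that, of h] h' nn
      by (meson mult_nonneg_nonneg zero_le_numeral)
    moreover have "\<forall>\<^sub>F s in at_bot. h s \<ge> h 0 + 1"
      using h_inf by (simp add: filterlim_at_top)
    ultimately show False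
      by (auto simp: eventually_at_bot_linorder) (smt (verit, best))
  qed
  then obtain t1 where t1: "\<phi> t1 \<bullet> \<phi>' t1 < 0" ..
  \<comment> \<open>By \<open>growth\<close> the quantity
    \<open>\<phi> \<bullet> \<phi>' + h / 3\<close> is nondecreasing, hence at most \<open>C\<close>
    to the left of \<open>t1\<close>. Once \<open>h \<ge> 6 * C\<close>, half of
    \<open>h / 3\<close> absorbs \<open>C\<close>, which leaves \<open>h' \<le> - h / 3\<close>:
    exponential growth towards -\<infinity>.\<close>
  define C where "C = \<phi> t1 \<bullet> \<phi>' t1 + h t1 / 3"
  have upper: "\<phi> s \<bullet> \<phi>' s + h s / 3 \<le> C" if "s \<le> t1" for s
    unfolding C_def
  proof (rule DERIV_nonneg_imp_nondecreasing[OF that], intro exI conjI)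
    fix x assume x: "s \<le> x" "x \<le> t1"
    show "((\<lambda>s. \<phi> s \<bullet> \<phi>' s + h s / 3) has_real_derivative
        (cmod (\<phi>' x))\<^sup>2 + Re (Q x) * (cmod (\<phi> x))\<^sup>2 + 2 * (\<phi> x \<bullet> \<phi>' x) / 3) (at x)"
      by (auto intro!: derivative_eq_intros h' inn[OF \<phi> \<phi>'])
    show "(cmod (\<phi>' x))\<^sup>2 + Re (Q x) * (cmod (\<phi> x))\<^sup>2 + 2 * (\<phi> x \<bullet> \<phi>' x) / 3 \<ge> 0"
      using growth[of "\<phi> x" "\<phi>' x" x] by linarith
  qed
  have "\<forall>\<^sub>F s in at_bot. h s \<ge> 6 * C" "\<forall>\<^sub>F s in at_bot. s \<le> t1"
    using h_inf by (simp_all add: filterlim_at_top eventually_le_at_bot)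
  then have "\<forall>\<^sub>F s in at_bot. 2 * (\<phi> s \<bullet> \<phi>' s) \<le> - h s / 3"
    by eventually_elim (use upper in fastforce)
  then obtain t2 where t2: "2 * (\<phi> s \<bullet> \<phi>' s) \<le> - h s / 3" if "s \<le> t2" for s
    by (auto simp: eventually_at_bot_linorder)
  have w: "((\<lambda>t. \<psi> t / \<phi> t) has_vector_derivative 1 / (\<phi> x)\<^sup>2) (at x)" for x
    using has_vector_derivative_quotient[OF \<psi> \<phi> nz, of x] by (simp add: wronskian)
  \<comment> \<open>The quotient has speed \<open>1 / h\<close>, and \<open>h' \<le> - h / 3\<close>
    makes this at most the derivative of \<open>3 / h\<close>. Integrating from -\<infinity>, where
    the quotient vanishes, bounds the product of the two norms by 3.\<close>
  have bound: "cmod (\<psi> t / \<phi> t) \<le> 3 / h t" if t: "t \<le> t2" for t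
  proof (rule tendsto_lowerbound)
    show "((\<lambda>s. 3 / h t + cmod (\<psi> s / \<phi> s)) \<longlongrightarrow> 3 / h t) at_bot"
      using tendsto_add[OF tendsto_const tendsto_norm[OF lim], of "3 / h t"] by simp
    show "\<forall>\<^sub>F s in at_bot. cmod (\<psi> t / \<phi> t) \<le> 3 / h t + cmod (\<psi> s / \<phi> s)"
      unfolding eventually_at_bot_linorder
    proof (intro exI allI impI)
      fix s assume s: "s \<le> t"
      have "cmod (\<psi> t / \<phi> t - \<psi> s / \<phi> s) \<le> 3 / h t - 3 / h s"
      proof (rule norm_diff_le_of_vector_derivative[OF s])
        fix x assume x: "s \<le> x" "x \<le> t"
        show "((\<lambda>t. \<psi> t / \<phi> t) has_vector_derivative 1 / (\<phi> x)\<^sup>2) (at x)" by (rule w)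
        show "((\<lambda>t. 3 / h t) has_real_derivative - (3 * (2 * (\<phi> x \<bullet> \<phi>' x))) / (h x)\<^sup>2) (at x)"
          using h_pos[of x] by (auto intro!: derivative_eq_intros h' simp: power2_eq_square)
        have "h x \<le> - (3 * (2 * (\<phi> x \<bullet> \<phi>' x)))" using t2[of x] x t by simp
        then have "h x / (h x)\<^sup>2 \<le> - (3 * (2 * (\<phi> x \<bullet> \<phi>' x))) / (h x)\<^sup>2"
          by (intro divide_right_mono) auto
        moreover have "cmod (1 / (\<phi> x)\<^sup>2) = h x / (h x)\<^sup>2"
          using h_pos[of x] by (simp add: norm_divide norm_power h_def[symmetric] power2_eq_square[of "h x"])
        ultimately show "cmod (1 / (\<phi> x)\<^sup>2) \<le> - (3 * (2 * (\<phi> x \<bullet> \<phi>' x))) / (h x)\<^sup>2"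
          by simp
      qed
      moreover have "3 / h s > 0" using h_pos by simp
      moreover have "cmod (\<psi> t / \<phi> t) \<le> cmod (\<psi> t / \<phi> t - \<psi> s / \<phi> s) + cmod (\<psi> s / \<phi> s)"
        by (metis diff_add_cancel norm_triangle_ineq)
      ultimately show "cmod (\<psi> t / \<phi> t) \<le> 3 / h t + cmod (\<psi> s / \<phi> s)" by linarith
    qed
  qed auto
  \<comment> \<open>Far to the left \<open>\<psi>\<close> has norm above 3 and \<open>\<phi>\<close>
    dominates it, so the product of the norms exceeds 3, against \<open>bound\<close>.\<close>
  have "\<forall>\<^sub>F s in at_bot. (cmod (\<psi> s))\<^sup>2 > 9" "\<forall>\<^sub>F s in at_bot. s \<le> t2"
    using \<psi>_inf by (auto simp: filterlim_at_top_dense eventually_le_at_bot)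
  from eventually_happens[OF eventually_conj[OF ev_le eventually_conj[OF this]]]
  obtain s where s: "(cmod (\<psi> s))\<^sup>2 \<le> h s" "(cmod (\<psi> s))\<^sup>2 > 9" "s \<le> t2"
    by (auto simp: trivial_limit_at_bot_linorder)
  have "cmod (\<psi> s) > 3" using s(2) by (intro power2_less_imp_less[of 3]) auto
  moreover from s(1) have "cmod (\<psi> s) \<le> cmod (\<phi> s)" by (simp add: h_def)
  moreover have "cmod (\<psi> s) * cmod (\<phi> s) \<le> 3"
    using bound[OF s(3)] nz[of s] by (simp add: h_def norm_divide field_simps power2_eq_square)
  moreover have "cmod (\<psi> s) * 1 \<le> cmod (\<psi> s) * cmod (\<phi> s)"
    using calculation by (intro mult_left_mono) auto
  ultimately show False by linarith
qed

text \<open>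
  A priori the logarithmic derivative \<open>v\<close> only lies in the right half plane. Its Cayley transform
  \<open>m\<close> is bounded, and \<open>m' = q (1 - m)\<^sup>2 - m\<close> improves the bound; then \<open>v - 1 / 2\<close> is bounded too,
  and its Riccati equation gives the sharp constant.
\<close>
lemma recessive_log_derivative_bound:
  fixes \<psi> \<psi>' \<phi> \<phi>' q :: "real \<Rightarrow> complex" and k :: real
  assumes \<psi>: "\<And>t. (\<psi> has_vector_derivative \<psi>' t) (at t)"
    and \<psi>': "\<And>t. (\<psi>' has_vector_derivative (1 / 4 + q t) * \<psi> t) (at t)"
    and \<phi>: "\<And>t. (\<phi> has_vector_derivative \<phi>' t) (at t)"
    and \<phi>': "\<And>t. (\<phi>' has_vector_derivative (1 / 4 + q t) * \<phi> t) (at t)"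
    and wronskian: "\<And>t. \<psi>' t * \<phi> t - \<psi> t * \<phi>' t = 1"
    and nz: "\<And>t. \<psi> t \<noteq> 0" "\<And>t. \<phi> t \<noteq> 0"
    and lim: "((\<lambda>t. \<psi> t / \<phi> t) \<longlongrightarrow> 0) at_bot"
    and k: "k < 1 / 2" "k - k\<^sup>2 \<le> 1 / 12"
    and q: "\<And>t. cmod (q t) \<le> k - k\<^sup>2"
  shows "cmod (\<psi>' t / \<psi> t - 1 / 2) \<le> k"
proof -
  define v where "v t = \<psi>' t / \<psi> t" for t
  have v': "(v has_vector_derivative 1 / 4 + q t - (v t)\<^sup>2) (at t)" for t
    using has_vector_derivative_quotient[OF \<psi>' \<psi> nz(1), of t] nz(1)[of t]
    by (simp add: v_def[abs_def] diff_divide_distrib power_divide power2_eq_square)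
  have q12: "cmod (q t) \<le> 1 / 12" for t using q[of t] k by linarith
  have Re_v: "Re (v t) \<ge> 0" for t
  proof -
    \<comment> \<open>Indeed 1/4 - 1/12 = 1/6 exceeds 1/9.\<close>
    have "Re (1 / 4 + q t) \<ge> 1 / 9" for t
      using q12[of t] abs_Re_le_cmod[of "q t"] by simp
    then have "\<psi> t \<bullet> \<psi>' t \<ge> 0"
      by (intro recessive_solution_increasing[of \<psi> \<psi>' "\<lambda>t. 1 / 4 + q t" \<phi> \<phi>'] assms) auto
    moreover have "Re (v t) = (\<psi> t \<bullet> \<psi>' t) / (cmod (\<psi> t))\<^sup>2"
      by (simp add: v_def Re_divide cmod_power2 inner_complex_def mult.commute)
    ultimately show ?thesis by simp
  qed
  define m where "m t = (v t - 1 / 2) / (v t + 1 / 2)" for t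
  have v_nz: "v t + 1 / 2 \<noteq> 0" for t
    using Re_v[of t] by (auto simp: complex_eq_iff)
  have m1: "cmod (m t) \<le> 1" for t
  proof -
    have "(cmod (v t - 1 / 2))\<^sup>2 \<le> (cmod (v t + 1 / 2))\<^sup>2"
      unfolding cmod_power2 using Re_v[of t] by (simp add: power2_eq_square algebra_simps)
    then have "cmod (v t - 1 / 2) \<le> cmod (v t + 1 / 2)" by simp
    moreover have "cmod (v t + 1 / 2) > 0" using v_nz[of t] unfolding zero_less_norm_iff .
    ultimately show ?thesis
      unfolding m_def norm_divide by (intro mult_imp_div_pos_le) (simp_all only: mult_1)
  qed
  have m': "(m has_vector_derivative q t * (1 - m t)\<^sup>2 - m t) (at t)" for t
  proof -
    have "((\<lambda>w. (w - 1 / 2) / (w + 1 / 2)) has_field_derivative 1 / (v t + 1 / 2)\<^sup>2) (at (v t))"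
      using v_nz[of t] by (auto intro!: derivative_eq_intros simp: power2_eq_square)
    from field_vector_diff_chain_at[OF v' this]
    have "(m has_vector_derivative (1 / 4 + q t - (v t)\<^sup>2) * (1 / (v t + 1 / 2)\<^sup>2)) (at t)"
      by (simp add: o_def m_def[abs_def])
    moreover have "(1 / 4 + q t - (v t)\<^sup>2) * (1 / (v t + 1 / 2)\<^sup>2) = q t * (1 - m t)\<^sup>2 - m t"
    proof -
      \<comment> \<open>In terms of the denominator \<open>N\<close> of the Cayley transform,
        \<open>1 - m = 1 / N\<close> and \<open>1 / 4 - v\<^sup>2 = - (N - 1) * N\<close>, which is
        why the equation for \<open>m\<close> is again polynomial.\<close>
      define N where "N = v t + 1 / 2"
      have "N \<noteq> 0" using v_nz[of t] by (simp add: N_def)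
      then have m1': "1 - m t = 1 / N" and m2: "m t = (N - 1) * N / N\<^sup>2"
        unfolding m_def N_def[symmetric]
        by (simp_all add: N_def[symmetric] field_simps power2_eq_square)
          (simp_all add: N_def field_simps)
      have v2: "1 / 4 + q t - (v t)\<^sup>2 = q t - (N - 1) * N"
        by (simp add: N_def power2_eq_square algebra_simps)
      have "q t * (1 - m t)\<^sup>2 - m t = q t * (1 / N)\<^sup>2 - (N - 1) * N / N\<^sup>2"
        unfolding m1' by (simp only: m2)
      then show ?thesis
        unfolding N_def[symmetric] v2 by (simp add: power_one_over diff_divide_distrib)
    qed
    ultimately show ?thesis by simp
  qed
  \<comment> \<open>The forcing has norm at most 1/12 times the square of 2.\<close>
  have m_third: "cmod (m t) \<le> 1 / 3" for t
  proof (rule bounded_solution_relaxation[OF m' m1])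
    fix t
    have "cmod (1 - m t) \<le> 2" using norm_triangle_ineq4[of 1 "m t"] m1[of t] by simp
    then have "(cmod (1 - m t))\<^sup>2 \<le> 2\<^sup>2" by (intro power_mono) auto
    then have "cmod (q t) * (cmod (1 - m t))\<^sup>2 \<le> 1 / 12 * 4"
      using q12[of t] by (intro mult_mono) auto
    then show "cmod (q t * (1 - m t)\<^sup>2) \<le> 1 / 3" by (simp add: norm_mult norm_power)
  qed
  define g where "g t = v t - 1 / 2" for t
  have g': "(g has_vector_derivative (q t - (g t)\<^sup>2) - g t) (at t)" for t
    unfolding g_def by (rule derivative_eq_intros v' refl)+ (simp add: power2_eq_square field_simps)
  have g_half: "cmod (g t) \<le> 1 / 2" for t
  proof -
    define N where "N = v t + 1 / 2"
    have N: "N \<noteq> 0" "g t = N - 1" "m t = (N - 1) / N"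
      using v_nz[of t] by (simp_all add: N_def g_def m_def)
    \<comment> \<open>Inverting the Cayley transform: \<open>g = m / (1 - m)\<close>, of norm at
      most (1/3) / (2/3).\<close>
    have "(N - 1) * (1 - (N - 1) / N) = (N - 1) / N" using N(1) by (simp add: field_simps)
    then have "g t * (1 - m t) = m t" unfolding N .
    then have "cmod (g t) * cmod (1 - m t) = cmod (m t)" by (metis norm_mult)
    moreover have "cmod (1 - m t) \<ge> 2 / 3"
      using norm_triangle_ineq2[of 1 "m t"] m_third[of t] by simp
    then have "cmod (g t) * (2 / 3) \<le> cmod (g t) * cmod (1 - m t)" by (intro mult_left_mono) auto
    ultimately show ?thesis using m_third[of t] by linarith
  qed
  have bdd: "bdd_above (range (\<lambda>t. cmod (g t)))" using g_half by (intro bdd_aboveI2)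
  \<comment> \<open>Relaxation with the best bound \<open>T\<close> as input gives
    \<open>T \<le> k - k\<^sup>2 + T\<^sup>2\<close>, so \<open>T\<close> lies outside the open
    interval between the roots \<open>k\<close> and \<open>1 - k\<close>. The a priori bound 1/2
    excludes the large root.\<close>
  define T where "T = (SUP t. cmod (g t))"
  have g_T: "cmod (g t) \<le> T" for t unfolding T_def by (rule cSUP_upper[OF _ bdd]) simp
  have "T \<le> 1 / 2" unfolding T_def by (rule cSUP_least) (use g_half in auto)
  have "T \<le> k - k\<^sup>2 + T\<^sup>2"
    unfolding T_def
  proof (rule cSUP_least)
    fix t
    show "cmod (g t) \<le> k - k\<^sup>2 + (SUP t. cmod (g t))\<^sup>2"
    proof (rule bounded_solution_relaxation[OF g' g_half])
      fix t
      have "cmod (q t - (g t)\<^sup>2) \<le> cmod (q t) + (cmod (g t))\<^sup>2"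
        using norm_triangle_ineq4[of "q t" "(g t)\<^sup>2"] by (simp add: norm_power)
      also have "\<dots> \<le> k - k\<^sup>2 + T\<^sup>2" using q[of t] g_T[of t] by (intro add_mono power_mono) auto
      finally show "cmod (q t - (g t)\<^sup>2) \<le> k - k\<^sup>2 + (SUP t. cmod (g t))\<^sup>2" by (simp add: T_def)
    qed
  qed simp
  then have "(T - k) * (1 - T - k) \<le> 0" by (simp add: algebra_simps power2_eq_square)
  moreover have "1 - T - k > 0" using \<open>T \<le> 1 / 2\<close> k by linarith
  ultimately have "T \<le> k" by (simp add: mult_le_0_iff)
  with g_T[of t] show ?thesis by (simp add: g_def v_def)
qed

section \<open>Comparison estimates for the vertical legs\<close>

text \<open>Jordan's inequality: the concave sine lies above its chord from 0 to \<pi>/2.\<close>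

lemma sin_ge_linear:
  assumes "0 \<le> x" "x \<le> pi / 2"
  shows "2 * x / pi \<le> sin x"
proof -
  have "convex_on {0..pi / 2} (\<lambda>x. - sin x)"
    by (rule convex_on_realI[where f' = "\<lambda>x. - cos x"])
      (auto intro!: derivative_eq_intros cos_monotone_0_pi_le)
  from convex_onD[OF this, of "2 * x / pi" 0 "pi / 2"] show ?thesis
    using assms by (simp add: field_simps)
qed

text \<open>
  Comparison with the strict supersolution \<open>23/20 k tan + 21/20 k\<close>; the factors exceeding \<open>1\<close>
  leave room for strictness, using that \<open>k\<close> is small.
\<close>
lemma riccati_comparison_tan:
  fixes u u' :: "real \<Rightarrow> complex" and k :: real
  assumes k: "0 < k" "k \<le> 1 / 10"
    and T: "0 \<le> T" "T < pi / 2"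
    and u: "\<And>\<tau>. 0 \<le> \<tau> \<Longrightarrow> \<tau> \<le> T \<Longrightarrow> (u has_vector_derivative u' \<tau>) (at \<tau>)"
    and u': "\<And>\<tau>. 0 \<le> \<tau> \<Longrightarrow> \<tau> \<le> T \<Longrightarrow> cmod (u' \<tau>) \<le> (k - k\<^sup>2) / (cos \<tau>)\<^sup>2 + (cmod (u \<tau>))\<^sup>2"
    and u0: "cmod (u 0) \<le> k"
  shows "cmod (u T) \<le> 39 / 25 * k / cos T"
proof -
  define G where "G \<tau> = 23 / 20 * k * tan \<tau> + 21 / 20 * k" for \<tau> :: real
  have cos_pos: "cos \<tau> > 0" if "0 \<le> \<tau>" "\<tau> \<le> T" for \<tau>
    using that T by (intro cos_gt_zero_pi) auto
  have G_nonneg: "G \<tau> \<ge> 0" if "0 \<le> \<tau>" "\<tau> \<le> T" for \<tau>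
    using that T k tan_gt_zero[of \<tau>] by (cases "\<tau> = 0") (auto simp: G_def)
  \<comment> \<open>Cauchy-Schwarz for \<open>G \<tau> * cos \<tau> = k * (23 / 20 * sin \<tau> + 21
    / 20 * cos \<tau>)\<close>; 97/40 is the sum of the squares of 23/20 and 21/20.\<close>
  have G_sq: "(G \<tau>)\<^sup>2 \<le> 97 / 40 * k\<^sup>2 / (cos \<tau>)\<^sup>2" if "0 \<le> \<tau>" "\<tau> \<le> T" for \<tau>
  proof -
    define c where "c = 23 / 20 * sin \<tau> + 21 / 20 * cos \<tau>"
    have "(23 / 20 * x + 21 / 20 * y)\<^sup>2 \<le> 97 / 40 * (x\<^sup>2 + y\<^sup>2)" for x y :: real
      using zero_le_power2[of "21 / 20 * x - 23 / 20 * y"] by (simp add: power2_eq_square algebra_simps)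
    then have "c\<^sup>2 \<le> 97 / 40 * ((sin \<tau>)\<^sup>2 + (cos \<tau>)\<^sup>2)"
      unfolding c_def .
    then have "k\<^sup>2 * c\<^sup>2 \<le> k\<^sup>2 * (97 / 40)"
      unfolding sin_cos_squared_add by (intro mult_left_mono) auto
    moreover have "G \<tau> * cos \<tau> = k * c"
      using cos_pos[OF that] by (simp add: G_def c_def tan_def field_simps)
    ultimately have "(G \<tau> * cos \<tau>)\<^sup>2 \<le> k\<^sup>2 * (97 / 40)"
      by (metis power_mult_distrib)
    then have "(G \<tau>)\<^sup>2 * (cos \<tau>)\<^sup>2 \<le> 97 / 40 * k\<^sup>2" by (simp add: power_mult_distrib)
    then show ?thesis using cos_pos[OF that] by (simp add: pos_le_divide_eq)
  qed
  have G': "(G has_real_derivative 23 / 20 * k / (cos \<tau>)\<^sup>2) (at \<tau>)" if "0 \<le> \<tau>" "\<tau> \<le> T" for \<tau>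
  proof -
    have eq: "23 / 20 * k / (cos \<tau>)\<^sup>2 = 23 / 20 * k * inverse ((cos \<tau>)\<^sup>2) + 0"
      by (simp only: divide_inverse add_0_right)
    have "cos \<tau> \<noteq> 0" using cos_pos[OF that] by simp
    then show ?thesis
      unfolding G_def eq by (intro DERIV_add DERIV_cmult DERIV_tan DERIV_const)
  qed
  \<comment> \<open>Up to the factor \<open>k / (cos \<tau>)\<^sup>2\<close> this reads
    \<open>1 - k + 97 / 40 * k \<le> 23 / 20\<close>, true for
    \<open>k \<le> 1 / 10\<close>.\<close>
  have super: "(k - k\<^sup>2) / (cos \<tau>)\<^sup>2 + (G \<tau>)\<^sup>2 \<le> 23 / 20 * k / (cos \<tau>)\<^sup>2" if "0 \<le> \<tau>" "\<tau> \<le> T" for \<tau>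
  proof -
    have "k * k \<le> k * (1 / 10)" using k by (intro mult_left_mono) auto
    then have "k - k\<^sup>2 + 97 / 40 * k\<^sup>2 \<le> 23 / 20 * k" using k by (simp add: power2_eq_square)
    then have "(k - k\<^sup>2) / (cos \<tau>)\<^sup>2 + 97 / 40 * k\<^sup>2 / (cos \<tau>)\<^sup>2 \<le> 23 / 20 * k / (cos \<tau>)\<^sup>2"
      unfolding add_divide_distrib[symmetric] by (intro divide_right_mono) auto
    with G_sq[OF that] show ?thesis by linarith
  qed
  have "cmod (u T) \<le> G T"
  proof (rule ccontr)
    assume bad: "\<not> cmod (u T) \<le> G T"
    define S where "S = {\<tau>\<in>{0..T}. cmod (u \<tau>) - G \<tau> \<ge> 0}"
    have cont: "continuous_on {0..T} (\<lambda>\<tau>. cmod (u \<tau>) - G \<tau>)"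
      by (intro continuous_intros continuous_at_imp_continuous_on ballI)
        (auto dest: u G' has_vector_derivative_continuous DERIV_isCont)
    have "closed S" unfolding S_def
      by (rule continuous_on_closed_Collect_le[where f = "\<lambda>_. 0", simplified]) (use cont in auto)
    moreover have "T \<in> S" using bad T by (simp add: S_def)
    moreover have "bdd_below S" by (rule bdd_belowI[of _ 0]) (simp add: S_def)
    ultimately have "Inf S \<in> S" by (intro closed_contains_Inf) auto
    \<comment> \<open>\<open>s\<close> is the first time at which \<open>cmod u\<close> reaches
      \<open>G\<close>. Before it \<open>u\<close> moves no faster than \<open>G\<close>, while
      \<open>G 0 = 21 / 20 * k\<close> starts strictly above \<open>cmod (u 0)\<close>, so
      \<open>G\<close> cannot have been reached.\<close>
    define s where "s = Inf S"
    have s: "0 \<le> s" "s \<le> T" "cmod (u s) \<ge> G s"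
      using \<open>Inf S \<in> S\<close> by (auto simp: S_def s_def)
    have before: "cmod (u \<tau>) \<le> G \<tau>" if "0 \<le> \<tau>" "\<tau> < s" for \<tau>
    proof (rule ccontr)
      assume "\<not> cmod (u \<tau>) \<le> G \<tau>"
      then have "\<tau> \<in> S" using that s by (auto simp: S_def)
      then have "s \<le> \<tau>" unfolding s_def using \<open>bdd_below S\<close> by (intro cInf_lower)
      with that show False by simp
    qed
    have "s \<noteq> 0" using s(3) u0 k by (auto simp: G_def)
    then have "0 < s" using s by simp
    have "cmod (u s - u 0) \<le> G s - G 0"
    proof (rule differentiable_bound_general[OF \<open>0 < s\<close>])
      show "continuous_on {0..s} u" "continuous_on {0..s} G"
        using s by (intro continuous_at_imp_continuous_on ballI;
          auto dest: u G' has_vector_derivative_continuous DERIV_isCont)+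
      fix \<tau> assume \<tau>: "0 < \<tau>" "\<tau> < s"
      show "(u has_vector_derivative u' \<tau>) (at \<tau>)" using u \<tau> s by simp
      show "(G has_vector_derivative 23 / 20 * k / (cos \<tau>)\<^sup>2) (at \<tau>)"
        using G'[of \<tau>] \<tau> s by (simp add: has_real_derivative_iff_has_vector_derivative)
      have "(cmod (u \<tau>))\<^sup>2 \<le> (G \<tau>)\<^sup>2" using before[of \<tau>] \<tau> by (intro power_mono) auto
      then show "cmod (u' \<tau>) \<le> 23 / 20 * k / (cos \<tau>)\<^sup>2"
        using u'[of \<tau>] super[of \<tau>] \<tau> s by simp
    qed
    moreover have "cmod (u s) \<le> cmod (u s - u 0) + cmod (u 0)"
      by (metis diff_add_cancel norm_triangle_ineq)
    ultimately show False using s u0 k by (simp add: G_def)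
  qed
  also have "\<dots> \<le> 39 / 25 * k / cos T"
  proof (rule power2_le_imp_le)
    \<comment> \<open>39/25 is a rational just above the square root of 97/40.\<close>
    have "97 / 40 * k\<^sup>2 \<le> (39 / 25 * k)\<^sup>2" by (simp add: power2_eq_square)
    then have "97 / 40 * k\<^sup>2 / (cos T)\<^sup>2 \<le> (39 / 25 * k)\<^sup>2 / (cos T)\<^sup>2" by (intro divide_right_mono) auto
    with G_sq[of T] T show "(G T)\<^sup>2 \<le> (39 / 25 * k / cos T)\<^sup>2" by (simp add: power_divide)
    show "0 \<le> 39 / 25 * k / cos T" using cos_pos[of T] T k by simp
  qed
  finally show ?thesis .
qed

text \<open>Along the segment from 0 to \<open>z\<close> the exponential moves no faster than its
  real counterpart along the segment from 0 to \<open>cmod z\<close>.\<close>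

lemma norm_exp_minus_1_le: "cmod (exp z - 1) \<le> exp (cmod z) - 1"
proof -
  have "((\<lambda>t. exp (of_real t * z)) has_vector_derivative z * exp (of_real t * z)) (at t)" for t
    by (rule has_vector_derivative_real_field) (auto intro!: derivative_eq_intros)
  then have "cmod (exp (of_real 1 * z) - exp (of_real 0 * z)) \<le> exp (1 * cmod z) - exp (0 * cmod z)"
    by (rule norm_diff_le_of_vector_derivative[where \<phi>' = "\<lambda>t. cmod z * exp (t * cmod z)", OF zero_le_one])
      (auto intro!: derivative_eq_intros mult_left_mono simp: norm_mult complex_Re_le_cmod)
  then show ?thesis by simp
qed

section \<open>Hill's equation on a strip\<close>

lemma open_horizontal_strip: "open (horizontal_strip a b)"
  unfolding horizontal_strip_def
  by (simp add: open_Collect_conj open_halfspace_Im_gt open_halfspace_Im_lt)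

lemma convex_horizontal_strip: "convex (horizontal_strip a b)"
proof -
  have "horizontal_strip a b = {z. Im z > a} \<inter> {z. Im z < b}"
    by (auto simp: horizontal_strip_def)
  then show ?thesis
    by (simp add: convex_Int convex_halfspace_Im_gt convex_halfspace_Im_lt)
qed

text \<open>
  The solutions \<open>exp (\<epsilon> y / 2) / s\<close>, \<open>\<epsilon> = \<plusminus>1\<close>, of Hill's equation come from the conjugation
  formula. The assumption \<open>recessive\<close> is what remains of the fact that \<open>y\<close> fixes \<open>\<plusminus>\<infinity>\<close>.
\<close>
locale hill_strip =
  fixes a b k :: real and q y s :: "complex \<Rightarrow> complex"
  assumes height: "b - a \<ge> pi"
    and k: "0 < k" "k \<le> 23 / 250" "k - k\<^sup>2 \<le> 1 / 12"
    and y_holo: "y holomorphic_on horizontal_strip a b"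
    and s_holo: "s holomorphic_on horizontal_strip a b"
    and s_sq: "\<And>z. z \<in> horizontal_strip a b \<Longrightarrow> (s z)\<^sup>2 = deriv y z"
    and s_nz: "\<And>z. z \<in> horizontal_strip a b \<Longrightarrow> s z \<noteq> 0"
    and hill: "\<And>\<epsilon> z. \<epsilon> \<in> {1, -1} \<Longrightarrow> z \<in> horizontal_strip a b \<Longrightarrow>
        deriv (deriv (\<lambda>z. exp (of_real \<epsilon> * y z / 2) / s z)) z
        = (1 / 4 + q z) * (exp (of_real \<epsilon> * y z / 2) / s z)"
    and q_edge: "\<And>x e \<sigma> h. (e, \<sigma>) \<in> {(a, 1), (b, -1)} \<Longrightarrow> 0 < h \<Longrightarrow> h \<le> pi / 2 \<Longrightarrow>
        cmod (q (Complex x (e + \<sigma> * h))) \<le> (k - k\<^sup>2) / (sin h)\<^sup>2"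
    and q_mid: "\<And>z. a + pi / 2 \<le> Im z \<Longrightarrow> Im z \<le> b - pi / 2 \<Longrightarrow> cmod (q z) \<le> k - k\<^sup>2"
    and recessive: "\<And>\<epsilon> \<eta>. \<epsilon> \<in> {1, -1} \<Longrightarrow> a < \<eta> \<Longrightarrow> \<eta> < b \<Longrightarrow>
        ((\<lambda>t. exp (of_real \<epsilon> * y (Complex (\<epsilon> * t) \<eta>))) \<longlongrightarrow> 0) at_bot"
begin

section \<open>Hill solutions and their Riccati equations\<close>

abbreviation B where "B \<equiv> horizontal_strip a b"

lemma mem_B: "z \<in> B \<longleftrightarrow> a < Im z \<and> Im z < b"
  by (simp add: horizontal_strip_def)

lemma y_deriv: "z \<in> B \<Longrightarrow> (y has_field_derivative deriv y z) (at z)"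
  using holomorphic_derivI[OF y_holo open_horizontal_strip] .

lemma s_deriv: "z \<in> B \<Longrightarrow> (s has_field_derivative deriv s z) (at z)"
  using holomorphic_derivI[OF s_holo open_horizontal_strip] .

text \<open>
  The logarithmic derivative of \<open>exp (\<epsilon> y / 2) / s\<close> in the direction \<open>\<epsilon>\<close>, minus its
  unperturbed value \<open>1 / 2\<close>.
\<close>
definition g :: "real \<Rightarrow> complex \<Rightarrow> complex" where
  "g \<epsilon> z = deriv y z / 2 - of_real \<epsilon> * deriv s z / s z - 1 / 2"

lemma deriv_y_g: "deriv y z = 1 + g 1 z + g (-1) z"
  by (simp add: g_def)

lemma log_deriv_s_g: "2 * (deriv s z / s z) = g (-1) z - g 1 z"
  by (simp add: g_def)

definition \<psi> :: "real \<Rightarrow> complex \<Rightarrow> complex" where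
  "\<psi> \<epsilon> z = exp (of_real \<epsilon> * y z / 2) / s z"

lemma \<psi>_nz: "z \<in> B \<Longrightarrow> \<psi> \<epsilon> z \<noteq> 0"
  by (simp add: \<psi>_def s_nz)

lemma \<psi>_deriv:
  assumes \<epsilon>: "\<epsilon> \<in> {1, -1}" and z: "z \<in> B"
  shows "(\<psi> \<epsilon> has_field_derivative of_real \<epsilon> * (g \<epsilon> z + 1 / 2) * \<psi> \<epsilon> z) (at z)"
proof -
  let ?e = "of_real \<epsilon> :: complex" and ?E = "\<lambda>z. exp (of_real \<epsilon> * y z / 2)"
  have nz: "s z \<noteq> 0" using s_nz[OF z] .
  have "(?E has_field_derivative ?E z * (?e * deriv y z / 2)) (at z)"
    by (auto intro!: derivative_eq_intros y_deriv[OF z])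
  from DERIV_divide[OF this s_deriv[OF z] nz]
  have "(\<psi> \<epsilon> has_field_derivative
      (?E z * (?e * deriv y z / 2) * s z - ?E z * deriv s z) / (s z * s z)) (at z)"
    by (simp only: \<psi>_def[abs_def])
  moreover have "?e * (g \<epsilon> z + 1 / 2) = ?e * deriv y z / 2 - deriv s z / s z"
    using \<epsilon> by (auto simp: g_def)
  moreover have "(X * (?e * Y / 2) * S - X * S') / (S * S) = (?e * Y / 2 - S' / S) * (X / S)"
    if "S \<noteq> 0" for X Y S S' :: complex
    using that by (simp add: divide_simps) (simp add: algebra_simps)
  from this[OF nz] have "(?E z * (?e * deriv y z / 2) * s z - ?E z * deriv s z) / (s z * s z)
      = (?e * deriv y z / 2 - deriv s z / s z) * \<psi> \<epsilon> z"
    unfolding \<psi>_def .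
  ultimately show ?thesis by simp
qed

lemma \<psi>_deriv2:
  assumes \<epsilon>: "\<epsilon> \<in> {1, -1}" and z: "z \<in> B"
  shows "((\<lambda>z. of_real \<epsilon> * (g \<epsilon> z + 1 / 2) * \<psi> \<epsilon> z) has_field_derivative (1 / 4 + q z) * \<psi> \<epsilon> z) (at z)"
proof -
  have "\<psi> \<epsilon> holomorphic_on B"
    unfolding \<psi>_def[abs_def] by (intro holomorphic_intros y_holo s_holo s_nz) auto
  then have "deriv (\<psi> \<epsilon>) holomorphic_on B"
    by (intro holomorphic_deriv open_horizontal_strip)
  then have "(deriv (\<psi> \<epsilon>) has_field_derivative deriv (deriv (\<psi> \<epsilon>)) z) (at z)"
    by (rule holomorphic_derivI[OF _ open_horizontal_strip z])
  moreover have "deriv (deriv (\<psi> \<epsilon>)) z = (1 / 4 + q z) * \<psi> \<epsilon> z"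
    using hill[OF \<epsilon> z] by (simp only: \<psi>_def[abs_def])
  ultimately have "(deriv (\<psi> \<epsilon>) has_field_derivative (1 / 4 + q z) * \<psi> \<epsilon> z) (at z)" by (simp only:)
  then show ?thesis
    by (rule has_field_derivative_transform_within_open[OF _ open_horizontal_strip z])
      (rule DERIV_imp_deriv[OF \<psi>_deriv[OF \<epsilon>]])
qed

text \<open>On the strip \<open>g = \<epsilon> * \<psi>' / \<psi> - 1 / 2\<close>, so the quotient
  rule turns the linear second-order equation into a Riccati equation;
  \<open>\<epsilon>\<^sup>2 = 1\<close> is used throughout.\<close>

lemma g_riccati:
  assumes \<epsilon>: "\<epsilon> \<in> {1, -1}" and z: "z \<in> B"
  shows "(g \<epsilon> has_field_derivative of_real \<epsilon> * (q z - g \<epsilon> z - (g \<epsilon> z)\<^sup>2)) (at z)"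
proof -
  let ?e = "of_real \<epsilon> :: complex"
  have e2: "?e * ?e = 1" using \<epsilon> by auto
  have nz: "\<psi> \<epsilon> z \<noteq> 0" using \<psi>_nz[OF z] .
  have "((\<lambda>z. ?e * (?e * (g \<epsilon> z + 1 / 2) * \<psi> \<epsilon> z / \<psi> \<epsilon> z) - 1 / 2) has_field_derivative
      ?e * ((((1 / 4 + q z) * \<psi> \<epsilon> z) * \<psi> \<epsilon> z - (?e * (g \<epsilon> z + 1 / 2) * \<psi> \<epsilon> z)
        * (?e * (g \<epsilon> z + 1 / 2) * \<psi> \<epsilon> z)) / (\<psi> \<epsilon> z * \<psi> \<epsilon> z)) - 0) (at z)"
    by (intro DERIV_diff DERIV_cmult DERIV_divide DERIV_const \<psi>_deriv2 \<psi>_deriv assms nz)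
  moreover have "?e * ((((1 / 4 + Q) * P) * P - (?e * (G + 1 / 2) * P) * (?e * (G + 1 / 2) * P)) / (P * P)) - 0
      = ?e * (Q - G - G\<^sup>2)" if "P \<noteq> 0" for P Q G :: complex
  proof -
    have "((1 / 4 + Q) * P) * P - (?e * (G + 1 / 2) * P) * (?e * (G + 1 / 2) * P)
        = ((1 / 4 + Q) - (?e * ?e) * (G + 1 / 2)\<^sup>2) * (P * P)"
      by (simp add: algebra_simps power2_eq_square)
    also have "(1 / 4 + Q) - (?e * ?e) * (G + 1 / 2)\<^sup>2 = Q - G - G\<^sup>2"
      unfolding e2 by (simp add: power2_eq_square algebra_simps)
    finally show ?thesis using that by simp
  qed
  ultimately have "((\<lambda>z. ?e * (?e * (g \<epsilon> z + 1 / 2) * \<psi> \<epsilon> z / \<psi> \<epsilon> z) - 1 / 2) has_field_derivative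
      ?e * (q z - g \<epsilon> z - (g \<epsilon> z)\<^sup>2)) (at z)" using nz by (simp only: not_False_eq_True)
  then show ?thesis
  proof (rule has_field_derivative_transform_within_open[OF _ open_horizontal_strip z])
    fix w assume "w \<in> B"
    then have "?e * (g \<epsilon> w + 1 / 2) * \<psi> \<epsilon> w / \<psi> \<epsilon> w = ?e * (g \<epsilon> w + 1 / 2)"
      using \<psi>_nz by simp
    then have "?e * (?e * (g \<epsilon> w + 1 / 2) * \<psi> \<epsilon> w / \<psi> \<epsilon> w) = (?e * ?e) * (g \<epsilon> w + 1 / 2)"
      by (simp only: mult.assoc)
    then show "?e * (?e * (g \<epsilon> w + 1 / 2) * \<psi> \<epsilon> w / \<psi> \<epsilon> w) - 1 / 2 = g \<epsilon> w"
      by (simp add: e2)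
  qed
qed

section \<open>Pointwise bounds on \<open>g\<close> and on \<open>deriv y\<close>\<close>

lemma g_mid:
  assumes \<epsilon>: "\<epsilon> \<in> {1, -1}" and z: "a + pi / 2 \<le> Im z" "Im z \<le> b - pi / 2"
  shows "cmod (g \<epsilon> z) \<le> k"
proof -
  let ?e = "of_real \<epsilon> :: complex"
  have e2: "?e * ?e = 1" "\<epsilon> * \<epsilon> = 1" and \<epsilon>': "- \<epsilon> \<in> {1, -1}" using \<epsilon> by auto
  \<comment> \<open>Traversed in the direction \<open>\<epsilon>\<close>, so that the recessive end
    is at t = -\<infinity> for either sign. The second solution is
    \<open>\<psi> (-\<epsilon>)\<close>, and the quotient of the two is
    \<open>exp (\<epsilon> * y)\<close>.\<close>
  define l where "l t = Complex (\<epsilon> * t) (Im z)" for t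
  have lB: "l t \<in> B" for t
    unfolding l_def mem_B complex.sel using z pi_gt_zero by (intro conjI; linarith)
  have l': "(l has_vector_derivative ?e) (at t)" for t
  proof -
    have "l = (\<lambda>t. of_real (\<epsilon> * t) + \<i> * of_real (Im z))"
      by (auto simp: l_def complex_eq_iff)
    then show ?thesis by (auto intro!: derivative_eq_intros simp: scaleR_conv_of_real)
  qed
  have chain: "((\<lambda>t. F (l t)) has_vector_derivative ?e * F') (at t)"
    if "(F has_field_derivative F') (at (l t))" for F F' t
    using field_vector_diff_chain_at[OF l' that] by (simp add: o_def)
  have lim: "((\<lambda>t. \<psi> \<epsilon> (l t) / \<psi> (-\<epsilon>) (l t)) \<longlongrightarrow> 0) at_bot"
  proof -
    have "\<psi> \<epsilon> (l t) / \<psi> (-\<epsilon>) (l t) = exp (of_real \<epsilon> * y (l t))" for t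
    proof -
      have "\<psi> \<epsilon> (l t) / \<psi> (-\<epsilon>) (l t) = exp (?e * y (l t) / 2) / exp (of_real (-\<epsilon>) * y (l t) / 2)"
        using s_nz[OF lB[of t]] by (simp add: \<psi>_def)
      also have "\<dots> = exp (?e * y (l t) / 2 - of_real (-\<epsilon>) * y (l t) / 2)"
        by (rule exp_diff[symmetric])
      finally show ?thesis by simp
    qed
    moreover have "a < Im z" "Im z < b" using z pi_gt_zero by linarith+
    ultimately show ?thesis using recessive[OF \<epsilon>] by (simp add: l_def)
  qed
  have ode1: "((\<lambda>t. \<psi> \<epsilon> (l t)) has_vector_derivative (g \<epsilon> (l t) + 1 / 2) * \<psi> \<epsilon> (l t)) (at t)" for t
    using chain[OF \<psi>_deriv[OF \<epsilon> lB]] by (simp add: mult.assoc[symmetric] e2)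
  have ode2: "((\<lambda>t. (g \<epsilon> (l t) + 1 / 2) * \<psi> \<epsilon> (l t)) has_vector_derivative
      (1 / 4 + q (l t)) * \<psi> \<epsilon> (l t)) (at t)" for t
    using has_vector_derivative_mult_right[OF chain[OF \<psi>_deriv2[OF \<epsilon> lB]], of ?e]
    by (simp add: mult.assoc[symmetric] e2)
  have ode3: "((\<lambda>t. \<psi> (-\<epsilon>) (l t)) has_vector_derivative - ((g (-\<epsilon>) (l t) + 1 / 2) * \<psi> (-\<epsilon>) (l t))) (at t)" for t
    using chain[OF \<psi>_deriv[OF \<epsilon>' lB], of t] by (simp add: mult.assoc[symmetric] e2)
  have ode4: "((\<lambda>t. - ((g (-\<epsilon>) (l t) + 1 / 2) * \<psi> (-\<epsilon>) (l t))) has_vector_derivative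
      (1 / 4 + q (l t)) * \<psi> (-\<epsilon>) (l t)) (at t)" for t
    using has_vector_derivative_mult_right[OF chain[OF \<psi>_deriv2[OF \<epsilon>' lB]], of ?e t]
    by (simp add: mult.assoc[symmetric] e2)
  \<comment> \<open>The product of the two solutions is \<open>1 / deriv y\<close>, while the two
    directional logarithmic derivatives add up to \<open>deriv y\<close>.\<close>
  have wronskian: "(g \<epsilon> (l t) + 1 / 2) * \<psi> \<epsilon> (l t) * \<psi> (-\<epsilon>) (l t)
      - \<psi> \<epsilon> (l t) * (- ((g (-\<epsilon>) (l t) + 1 / 2) * \<psi> (-\<epsilon>) (l t))) = 1" for t
  proof -
    have "\<psi> \<epsilon> (l t) * \<psi> (-\<epsilon>) (l t) = 1 / deriv y (l t)"
      unfolding s_sq[OF lB[of t], symmetric]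
      by (simp add: \<psi>_def times_divide_times_eq mult_exp_exp power2_eq_square)
    moreover have "g \<epsilon> (l t) + 1 / 2 + (g (-\<epsilon>) (l t) + 1 / 2) = deriv y (l t)"
      by (simp add: g_def)
    moreover have "deriv y (l t) \<noteq> 0" using s_sq[OF lB[of t]] s_nz[OF lB[of t]] by auto
    moreover have "(A * P * R - P * (- (C * R))) = (A + C) * (P * R)" for A C P R :: complex
      by (simp add: algebra_simps)
    ultimately show ?thesis by simp
  qed
  have "cmod ((g \<epsilon> (l (\<epsilon> * Re z)) + 1 / 2) * \<psi> \<epsilon> (l (\<epsilon> * Re z)) / \<psi> \<epsilon> (l (\<epsilon> * Re z)) - 1 / 2) \<le> k"
    by (rule recessive_log_derivative_bound[OF ode1 ode2 ode3 ode4 wronskian \<psi>_nz \<psi>_nz lim])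
      (use k q_mid z lB in \<open>auto simp: l_def\<close>)
  moreover have "l (\<epsilon> * Re z) = z" using e2 by (simp add: l_def mult.assoc[symmetric])
  ultimately show ?thesis using \<psi>_nz[of z \<epsilon>] lB[of "\<epsilon> * Re z"] by simp
qed

lemma edge_path_deriv:
  assumes "\<sigma> \<in> {1, -1 :: real}" and F: "(F has_field_derivative F') (at (Complex x (e + \<sigma> * h)))"
  shows "((\<lambda>h. F (Complex x (e + \<sigma> * h))) has_vector_derivative \<i> * of_real \<sigma> * F') (at h)"
proof -
  have "(\<lambda>h. Complex x (e + \<sigma> * h)) = (\<lambda>h. of_real x + \<i> * (of_real e + of_real (\<sigma> * h)))"
    by (auto simp: complex_eq_iff)
  then have "((\<lambda>h. Complex x (e + \<sigma> * h)) has_vector_derivative \<i> * of_real \<sigma>) (at h)"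
    by (auto intro!: derivative_eq_intros simp: scaleR_conv_of_real)
  from field_vector_diff_chain_at[OF this F] show ?thesis by (simp add: o_def)
qed

text \<open>A pair \<open>(e, \<sigma>)\<close> is an edge with its inward direction, so both edges
  are treated at once and \<open>h\<close> is the distance from \<open>e\<close>. As the height is
  at least \<pi>, legs of length \<pi>/2 fit.\<close>

lemma edge_path_mem:
  assumes "(e, \<sigma>) \<in> {(a, 1), (b, -1)}" "0 < h" "h \<le> pi / 2"
  shows "Complex x (e + \<sigma> * h) \<in> B"
  using assms height pi_gt_zero by (auto simp: mem_B)

lemma edge_path_mid:
  assumes "(e, \<sigma>) \<in> {(a, 1), (b, -1)}"
  shows "a + pi / 2 \<le> Im (Complex x (e + \<sigma> * (pi / 2)))" "Im (Complex x (e + \<sigma> * (pi / 2))) \<le> b - pi / 2"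
  using assms height by auto

lemma g_edge:
  assumes \<epsilon>: "\<epsilon> \<in> {1, -1}" and e: "(e, \<sigma>) \<in> {(a, 1), (b, -1)}" and h: "0 < h" "h \<le> pi / 2"
  shows "cmod (g \<epsilon> (Complex x (e + \<sigma> * h))) \<le> 39 / 25 * k / sin h"
proof -
  \<comment> \<open>\<open>\<zeta>\<close> is \<epsilon> times the velocity of the path
    \<open>w\<close>, which runs from the middle towards the edge. It is purely imaginary, so the
    integrating factor in \<open>u\<close> has modulus 1: it removes the linear Riccati term without
    changing the norm.\<close>
  define \<zeta> where "\<zeta> = - \<i> * of_real (\<sigma> * \<epsilon>)"
  define w where "w \<tau> = Complex x (e + \<sigma> * (pi / 2 - \<tau>))" for \<tau>
  define u where "u \<tau> = exp (of_real \<tau> * \<zeta>) * g \<epsilon> (w \<tau>)" for \<tau>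
  have \<sigma>: "\<sigma> \<in> {1, -1}" using e by auto
  have norm_exp: "cmod (exp (of_real \<tau> * \<zeta>)) = 1" for \<tau> :: real
    by (simp add: \<zeta>_def)
  have norm_\<zeta>: "cmod \<zeta> = 1" using \<sigma> \<epsilon> by (auto simp: \<zeta>_def norm_mult)
  have u': "(u has_vector_derivative exp (of_real \<tau> * \<zeta>) * (\<zeta> * (q (w \<tau>) - (g \<epsilon> (w \<tau>))\<^sup>2))) (at \<tau>)"
    if \<tau>: "0 \<le> \<tau>" "\<tau> \<le> pi / 2 - h" for \<tau>
  proof -
    have wB: "w \<tau> \<in> B" using edge_path_mem[OF e] \<tau> h by (simp add: w_def)
    have "((\<lambda>h. g \<epsilon> (Complex x ((e + \<sigma> * (pi / 2)) + (- \<sigma>) * h))) has_vector_derivative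
        \<i> * of_real (- \<sigma>) * (of_real \<epsilon> * (q (w \<tau>) - g \<epsilon> (w \<tau>) - (g \<epsilon> (w \<tau>))\<^sup>2))) (at \<tau>)"
      using \<sigma> by (intro edge_path_deriv) (use g_riccati[OF \<epsilon> wB] in \<open>auto simp: w_def algebra_simps\<close>)
    then have "((\<lambda>\<tau>. g \<epsilon> (w \<tau>)) has_vector_derivative \<zeta> * (q (w \<tau>) - g \<epsilon> (w \<tau>) - (g \<epsilon> (w \<tau>))\<^sup>2)) (at \<tau>)"
      by (simp add: w_def[abs_def] \<zeta>_def algebra_simps)
    moreover have "((\<lambda>\<tau>. exp (of_real \<tau> * \<zeta>)) has_vector_derivative \<zeta> * exp (of_real \<tau> * \<zeta>)) (at \<tau>)"
      by (rule has_vector_derivative_real_field) (auto intro!: derivative_eq_intros)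
    ultimately have "(u has_vector_derivative exp (of_real \<tau> * \<zeta>) *
        (\<zeta> * (q (w \<tau>) - g \<epsilon> (w \<tau>) - (g \<epsilon> (w \<tau>))\<^sup>2)) + \<zeta> * exp (of_real \<tau> * \<zeta>) * g \<epsilon> (w \<tau>)) (at \<tau>)"
      unfolding u_def[abs_def] by (rule has_vector_derivative_mult[rotated])
    then show ?thesis by (simp add: algebra_simps)
  qed
  have "cmod (u (pi / 2 - h)) \<le> 39 / 25 * k / cos (pi / 2 - h)"
  proof (rule riccati_comparison_tan[OF _ _ _ _ u'])
    show "0 < k" "k \<le> 1 / 10" using k by auto
    show "0 \<le> pi / 2 - h" "pi / 2 - h < pi / 2" using h by auto
    show "cmod (u 0) \<le> k" using g_mid[OF \<epsilon> edge_path_mid[OF e]] by (simp add: u_def w_def)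
    fix \<tau> assume \<tau>: "0 \<le> \<tau>" "\<tau> \<le> pi / 2 - h"
    have "cmod (q (w \<tau>)) \<le> (k - k\<^sup>2) / (cos \<tau>)\<^sup>2"
      using q_edge[OF e, of "pi / 2 - \<tau>" x] \<tau> h by (simp add: w_def sin_diff)
    moreover have "cmod (q (w \<tau>) - (g \<epsilon> (w \<tau>))\<^sup>2) \<le> cmod (q (w \<tau>)) + (cmod (u \<tau>))\<^sup>2"
      using norm_triangle_ineq4[of "q (w \<tau>)" "(g \<epsilon> (w \<tau>))\<^sup>2"]
      unfolding u_def norm_mult norm_exp by (simp add: norm_power)
    ultimately show "cmod (exp (of_real \<tau> * \<zeta>) * (\<zeta> * (q (w \<tau>) - (g \<epsilon> (w \<tau>))\<^sup>2)))
        \<le> (k - k\<^sup>2) / (cos \<tau>)\<^sup>2 + (cmod (u \<tau>))\<^sup>2"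
      unfolding norm_mult norm_exp norm_\<zeta> by simp
  qed
  then show ?thesis unfolding u_def w_def norm_mult norm_exp by (simp add: cos_diff)
qed

lemma deriv_y_mid:
  assumes "a + pi / 2 \<le> Im z" "Im z \<le> b - pi / 2"
  shows "cmod (deriv y z - 1) \<le> 2 * k"
  using g_mid[of 1, OF _ assms] g_mid[of "-1", OF _ assms] norm_triangle_ineq[of "g 1 z" "g (-1) z"]
  by (simp add: deriv_y_g)

text \<open>With a logarithm \<open>L\<close> of \<open>s\<close> one has
  \<open>deriv y = exp (2 * L)\<close>, and the derivative of \<open>2 * L\<close> is a difference
  of the two \<open>g\<close>. Its bound of order \<open>k / t\<close> integrates to a logarithm
  from the middle, where \<open>deriv y\<close> is known.\<close>

lemma deriv_y_edge:
  assumes e: "(e, \<sigma>) \<in> {(a, 1), (b, -1)}" and h: "0 < h" "h \<le> pi / 2"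
  shows "cmod (deriv y (Complex x (e + \<sigma> * h)) - 1) \<le> (1 + 2 * k) * exp (5 * k * (ln (pi / 2) - ln h)) - 1"
proof -
  define w where "w h = Complex x (e + \<sigma> * h)" for h
  have wB: "w t \<in> B" if "0 < t" "t \<le> pi / 2" for t using edge_path_mem[OF e that] by (simp add: w_def)
  have \<sigma>: "\<sigma> \<in> {1, -1}" using e by auto
  obtain L where L: "L holomorphic_on B" "\<And>z. z \<in> B \<Longrightarrow> s z = exp (L z)"
    using contractible_imp_holomorphic_log[OF s_holo convex_imp_contractible[OF convex_horizontal_strip] s_nz]
    by blast
  have L': "(L has_field_derivative deriv s z / s z) (at z)" if z: "z \<in> B" for z
  proof -
    have L': "(L has_field_derivative deriv L z) (at z)"
      using holomorphic_derivI[OF L(1) open_horizontal_strip z] .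
    then have "((\<lambda>z. exp (L z)) has_field_derivative exp (L z) * deriv L z) (at z)"
      by (auto intro!: derivative_eq_intros)
    then have "(s has_field_derivative exp (L z) * deriv L z) (at z)"
      by (rule has_field_derivative_transform_within_open[OF _ open_horizontal_strip z]) (simp add: L(2))
    then have "deriv s z = s z * deriv L z" using L(2)[OF z] by (metis DERIV_imp_deriv)
    with L' show ?thesis using s_nz[OF z] by simp
  qed
  define E where "E = 2 * L (w h) - 2 * L (w (pi / 2))"
  have "cmod (2 * L (w (pi / 2)) - 2 * L (w h)) \<le> 5 * k * ln (pi / 2) - 5 * k * ln h"
  proof (rule norm_diff_le_of_vector_derivative[OF h(2)])
    fix t assume t: "h \<le> t" "t \<le> pi / 2"
    then have t0: "0 < t" using h by simp
    show "((\<lambda>t. 2 * L (w t)) has_vector_derivative 2 * (\<i> * of_real \<sigma> * (deriv s (w t) / s (w t)))) (at t)"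
      unfolding w_def using L'[OF wB[OF t0 t(2)]] \<sigma>
      by (intro has_vector_derivative_mult_right edge_path_deriv) (auto simp: w_def)
    show "((\<lambda>t. 5 * k * ln t) has_real_derivative 5 * k / t) (at t)"
      using t0 by (auto intro!: derivative_eq_intros)
    have "cmod (2 * (\<i> * of_real \<sigma> * (deriv s (w t) / s (w t)))) = cmod (2 * (deriv s (w t) / s (w t)))"
      using \<sigma> by (auto simp: norm_mult norm_divide)
    also have "\<dots> \<le> cmod (g (-1) (w t)) + cmod (g 1 (w t))"
      unfolding log_deriv_s_g by (rule norm_triangle_ineq4)
    also have "\<dots> \<le> 39 / 25 * k / sin t + 39 / 25 * k / sin t"
      unfolding w_def by (intro add_mono g_edge e t0 t) auto
    also have "\<dots> = 78 / 25 * k / sin t" by simp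
    also have "\<dots> \<le> 78 / 25 * k / (2 * t / pi)"
      using k t t0 sin_ge_linear[of t] by (intro divide_left_mono mult_pos_pos sin_gt_zero) auto
    also have "\<dots> = (39 / 25 * pi) * k / t" using t0 by simp
    also have "\<dots> \<le> 5 * k / t"
      \<comment> \<open>39/25 times \<pi> is about 4.9.\<close>
      using k t0 pi_approx by (intro divide_right_mono mult_right_mono) auto
    finally show "cmod (2 * (\<i> * of_real \<sigma> * (deriv s (w t) / s (w t)))) \<le> 5 * k / t" .
  qed
  then have E: "cmod E \<le> 5 * k * (ln (pi / 2) - ln h)"
    by (simp add: E_def norm_minus_commute right_diff_distrib)
  define X where "X = exp (5 * k * (ln (pi / 2) - ln h))"
  define d where "d = deriv y (w (pi / 2))"
  have "cmod (exp E - 1) \<le> exp (cmod E) - 1" by (rule norm_exp_minus_1_le)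
  also have "\<dots> \<le> X - 1" using E by (simp add: X_def)
  finally have expE: "cmod (exp E - 1) \<le> X - 1" .
  have d1: "cmod (d - 1) \<le> 2 * k" unfolding d_def w_def by (rule deriv_y_mid edge_path_mid e)+
  then have "cmod d \<le> 1 + 2 * k" using norm_triangle_ineq[of "d - 1" 1] by simp
  have y's: "deriv y z = exp (2 * L z)" if "z \<in> B" for z
    using s_sq[OF that] L(2)[OF that] by (simp add: exp_double)
  have "deriv y (w h) = d * exp E"
    using wB[OF h] wB[of "pi / 2"] by (simp add: y's d_def E_def mult_exp_exp)
  then have "cmod (deriv y (w h) - 1) = cmod (d * (exp E - 1) + (d - 1))" by (simp add: algebra_simps)
  also have "\<dots> \<le> cmod d * cmod (exp E - 1) + cmod (d - 1)" by (metis norm_mult norm_triangle_ineq)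
  also have "\<dots> \<le> (1 + 2 * k) * (X - 1) + 2 * k"
    using expE d1 \<open>cmod d \<le> 1 + 2 * k\<close> k by (intro add_mono mult_mono) auto
  also have "\<dots> = (1 + 2 * k) * X - 1" by (simp add: algebra_simps)
  finally show ?thesis by (simp add: w_def X_def)
qed

section \<open>Integrated bounds for the displacement \<open>y z - z\<close>\<close>

lemma displacement_edge:
  fixes x e \<sigma> h :: real
  assumes e: "(e, \<sigma>) \<in> {(a, 1), (b, -1)}" and h: "0 < h" "h \<le> pi / 2"
  defines "w \<equiv> \<lambda>h. Complex x (e + \<sigma> * h)"
  shows "cmod ((y (w h) - w h) - (y (w (pi / 2)) - w (pi / 2))) \<le> pi / 2 * (7 * k / (1 - 5 * k))"
proof -
  have wB: "w t \<in> B" if "0 < t" "t \<le> pi / 2" for t using edge_path_mem[OF e that] by (simp add: w_def)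
  have \<sigma>: "\<sigma> \<in> {1, -1}" using e by auto
  \<comment> \<open>\<open>X t\<close> is the power \<open>(pi / (2 * t))\<close> to the exponent
    \<open>5 * k < 1\<close>, integrable at the edge. The constant \<open>c\<close> makes
    \<open>c * (t * X t) - t\<close> an antiderivative of the bound
    \<open>(1 + 2 * k) * X t - 1\<close>.\<close>
  define X where "X t = exp (5 * k * (ln (pi / 2) - ln t))" for t
  define c where "c = (1 + 2 * k) / (1 - 5 * k)"
  have c: "c * (1 - 5 * k) = 1 + 2 * k" "c \<ge> 1" using k by (auto simp: c_def)
  have "cmod ((y (w (pi / 2)) - w (pi / 2)) - (y (w h) - w h))
    \<le> (c * ((pi / 2) * X (pi / 2)) - pi / 2) - (c * (h * X h) - h)"
  proof (rule norm_diff_le_of_vector_derivative[OF h(2)])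
    fix t assume t: "h \<le> t" "t \<le> pi / 2"
    then have t0: "0 < t" using h by simp
    have "((\<lambda>z. y z - z) has_field_derivative deriv y (w t) - 1) (at (w t))"
      by (intro DERIV_diff y_deriv wB t0 t DERIV_ident)
    then show "((\<lambda>t. y (w t) - w t) has_vector_derivative \<i> * of_real \<sigma> * (deriv y (w t) - 1)) (at t)"
      unfolding w_def using \<sigma> by (intro edge_path_deriv[where F = "\<lambda>z. y z - z"]) auto
    have X': "(X has_real_derivative - (5 * k) / t * X t) (at t)"
      unfolding X_def[abs_def] using t0 by (auto intro!: derivative_eq_intros)
    have "((\<lambda>t. c * (t * X t) - t) has_real_derivative c * (t * (- (5 * k) / t * X t) + 1 * X t) - 1) (at t)"
      by (intro DERIV_diff DERIV_cmult DERIV_mult' X' DERIV_ident)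
    moreover have "c * (t * (- (5 * k) / t * X t) + 1 * X t) - 1 = (c * (1 - 5 * k)) * X t - 1"
      using t0 by (simp add: algebra_simps)
    ultimately show "((\<lambda>t. c * (t * X t) - t) has_real_derivative (1 + 2 * k) * X t - 1) (at t)"
      by (simp only: c)
    have "cmod (\<i> * of_real \<sigma> * (deriv y (w t) - 1)) = cmod (deriv y (w t) - 1)"
      using \<sigma> by (auto simp: norm_mult)
    then show "cmod (\<i> * of_real \<sigma> * (deriv y (w t) - 1)) \<le> (1 + 2 * k) * X t - 1"
      using deriv_y_edge[OF e t0 t(2)] by (simp add: X_def w_def)
  qed
  \<comment> \<open>Dropping the term at \<open>h\<close> makes the bound uniform up to the
    edge.\<close>
  moreover have "c * (h * X h) - h \<ge> 0"
  proof -
    have "ln h \<le> ln (pi / 2)" using h by simp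
    then have "X h \<ge> 1" using k by (simp add: X_def)
    with c(2) have "1 * 1 \<le> c * X h" by (intro mult_mono) auto
    then have "h * 1 \<le> h * (c * X h)" using h by (intro mult_left_mono) auto
    then show ?thesis by (simp add: algebra_simps)
  qed
  moreover have "c * ((pi / 2) * X (pi / 2)) - pi / 2 = pi / 2 * (c - 1)" by (simp add: X_def algebra_simps)
  moreover have "c - 1 = 7 * k / (1 - 5 * k)" using k by (simp add: c_def field_simps)
  ultimately show ?thesis by (simp add: norm_minus_commute)
qed

lemma displacement_mid:
  assumes "a + pi / 2 \<le> Im z" "Im z \<le> b - pi / 2" "a + pi / 2 \<le> Im w" "Im w \<le> b - pi / 2"
  shows "cmod ((y z - z) - (y w - w)) \<le> 2 * k * cmod (z - w)"
proof (rule field_differentiable_bound)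
  let ?S = "{z. a + pi / 2 \<le> Im z} \<inter> {z. Im z \<le> b - pi / 2}"
  show "convex ?S" by (intro convex_Int convex_halfspace_Im_ge convex_halfspace_Im_le)
  fix u assume u: "u \<in> ?S"
  then have "a + pi / 2 \<le> Im u" "Im u \<le> b - pi / 2" by auto
  then have "u \<in> B" using pi_gt_zero unfolding mem_B by (intro conjI; linarith)
  then have "((\<lambda>z. y z - z) has_field_derivative deriv y u - 1) (at u)"
    by (intro DERIV_diff y_deriv DERIV_ident)
  then show "((\<lambda>z. y z - z) has_field_derivative deriv y u - 1) (at u within ?S)"
    by (rule has_field_derivative_at_within)
  show "cmod (deriv y u - 1) \<le> 2 * k" using u by (intro deriv_y_mid) auto
qed (use assms in auto)

text \<open>Vertical projection to the middle strip, which degenerates to a line if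
  \<open>b - a = pi\<close>; the image is the inner end of the leg through \<open>z\<close>.\<close>

definition clamp_mid :: "complex \<Rightarrow> complex" where
  "clamp_mid z = Complex (Re z) (max (a + pi / 2) (min (b - pi / 2) (Im z)))"

lemma clamp_mid: "a + pi / 2 \<le> Im (clamp_mid z)" "Im (clamp_mid z) \<le> b - pi / 2"
  using height by (auto simp: clamp_mid_def)

lemma clamp_mid_mem: "clamp_mid z \<in> B"
  using clamp_mid[of z] pi_gt_zero unfolding mem_B by (intro conjI; linarith)

lemma norm_clamp_mid_diff: "cmod (clamp_mid z - clamp_mid w) \<le> \<bar>Re (z - w)\<bar> + \<bar>Im (z - w)\<bar>"
proof -
  have "cmod (clamp_mid z - clamp_mid w) \<le> \<bar>Re (clamp_mid z - clamp_mid w)\<bar> + \<bar>Im (clamp_mid z - clamp_mid w)\<bar>"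
    by (rule cmod_le)
  also have "\<dots> \<le> \<bar>Re (z - w)\<bar> + \<bar>Im (z - w)\<bar>"
    by (auto simp: clamp_mid_def)
  finally show ?thesis .
qed

lemma displacement_clamp_mid:
  assumes z: "z \<in> B"
  shows "cmod ((y z - z) - (y (clamp_mid z) - clamp_mid z)) \<le> pi / 2 * (7 * k / (1 - 5 * k))"
proof -
  consider "Im z \<le> a + pi / 2" | "Im z \<ge> b - pi / 2" | "a + pi / 2 \<le> Im z" "Im z \<le> b - pi / 2"
    by linarith
  then show ?thesis
  proof cases
    case 1
    then have "z = Complex (Re z) (a + 1 * (Im z - a))" "clamp_mid z = Complex (Re z) (a + 1 * (pi / 2))"
      using height by (auto simp: clamp_mid_def complex_eq_iff)
    then show ?thesis using displacement_edge[of a 1 "Im z - a" "Re z"] z 1 by (simp add: mem_B)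
  next
    case 2
    then have "z = Complex (Re z) (b + (-1) * (b - Im z))" "clamp_mid z = Complex (Re z) (b + (-1) * (pi / 2))"
      using height by (auto simp: clamp_mid_def complex_eq_iff)
    then show ?thesis using displacement_edge[of b "-1" "b - Im z" "Re z"] z 2 by (simp add: mem_B)
  next
    case 3
    then have "clamp_mid z = z" by (auto simp: clamp_mid_def complex_eq_iff)
    then show ?thesis using k by simp
  qed
qed

text \<open>The interior bound is uniform in the distance to the edge, and \<open>clamp_mid\<close>
  is continuous with values inside the strip, so the bound survives in the limit.\<close>

lemma displacement_boundary_value:
  assumes z: "z islimpt B" and lim: "(y \<longlongrightarrow> z') (at z within B)"
  shows "cmod ((z' - z) - (y (clamp_mid z) - clamp_mid z)) \<le> pi / 2 * (7 * k / (1 - 5 * k))"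
proof (rule tendsto_upperbound)
  have cont: "isCont clamp_mid z"
    unfolding clamp_mid_def[abs_def] Complex_eq
    by (intro continuous_intros isCont_Re[OF continuous_ident] isCont_Im[OF continuous_ident])
  have "isCont y (clamp_mid z)" using y_deriv[OF clamp_mid_mem] by (rule DERIV_isCont)
  then have "isCont (\<lambda>z. y (clamp_mid z)) z" using cont by (rule isCont_o2[rotated])
  with cont show "((\<lambda>z. cmod ((y z - z) - (y (clamp_mid z) - clamp_mid z))) \<longlongrightarrow>
      cmod ((z' - z) - (y (clamp_mid z) - clamp_mid z))) (at z within B)"
    by (intro tendsto_intros lim) (auto simp: isCont_def intro: tendsto_within_subset)
  show "\<forall>\<^sub>F z in at z within B. cmod ((y z - z) - (y (clamp_mid z) - clamp_mid z)) \<le> pi / 2 * (7 * k / (1 - 5 * k))"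
    unfolding eventually_at_filter by (intro always_eventually allI impI displacement_clamp_mid)
  show "at z within B \<noteq> bot" using z by (simp add: trivial_limit_within)
qed

lemma displacement_bound:
  assumes "z islimpt B" "w islimpt B" "(y \<longlongrightarrow> z') (at z within B)" "(y \<longlongrightarrow> w') (at w within B)"
  shows "cmod ((z' - w') - (z - w)) \<le> pi * (7 * k / (1 - 5 * k)) + 2 * k * (\<bar>Re (z - w)\<bar> + \<bar>Im (z - w)\<bar>)"
proof -
  define D where "D z = y (clamp_mid z) - clamp_mid z" for z
  have "(z' - w') - (z - w) = ((z' - z) - D z) - ((w' - w) - D w) + (D z - D w)" by simp
  also have "cmod \<dots> \<le> cmod ((z' - z) - D z) + cmod ((w' - w) - D w) + cmod (D z - D w)"
    by (intro norm_triangle_le add_mono norm_triangle_ineq4 order_refl)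
  also have "cmod (D z - D w) \<le> 2 * k * cmod (clamp_mid z - clamp_mid w)"
    unfolding D_def by (intro displacement_mid clamp_mid)
  also have "\<dots> \<le> 2 * k * (\<bar>Re (z - w)\<bar> + \<bar>Im (z - w)\<bar>)"
    using k by (intro mult_left_mono norm_clamp_mid_diff) auto
  finally show ?thesis
    using displacement_boundary_value[OF assms(1,3), folded D_def]
      displacement_boundary_value[OF assms(2,4), folded D_def]
    by linarith
qed

end

section \<open>Closed strips in the doubly extended plane\<close>

lemma Fin_mem_ext_closureD:
  assumes "Fin z \<in> ext_closure S"
  shows "z \<in> closure S"
  unfolding closure_iff_nhds_not_empty
proof (intro allI impI)
  fix A V assume V: "V \<subseteq> A" "open V" "z \<in> V"
  have "open (Fin ` V)" using V by (simp add: open_Fin_image_iff)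
  moreover have "Fin z \<in> Fin ` V" using V by simp
  ultimately have "Fin ` S \<inter> Fin ` V \<noteq> {}"
    using assms unfolding ext_closure_def closure_iff_nhds_not_empty by (meson order_refl)
  then show "S \<inter> A \<noteq> {}" using V by auto
qed

lemma closure_horizontal_strip:
  assumes "a < b"
  shows "closure (horizontal_strip a b) = {z. a \<le> Im z \<and> Im z \<le> b}"
proof
  have "closed {z. a \<le> Im z \<and> Im z \<le> b}"
    by (simp add: closed_Collect_conj closed_halfspace_Im_ge closed_halfspace_Im_le)
  then show "closure (horizontal_strip a b) \<subseteq> {z. a \<le> Im z \<and> Im z \<le> b}"
    by (intro closure_minimal) (auto simp: horizontal_strip_def)
  show "{z. a \<le> Im z \<and> Im z \<le> b} \<subseteq> closure (horizontal_strip a b)"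
    using Fin_mem_ext_closureD[of _ "horizontal_strip a b"]
    by (auto simp: ext_closure_horizontal_strip[OF assms])
qed

lemma frontier_horizontal_strip:
  assumes "a < b"
  shows "frontier (horizontal_strip a b) = {z. Im z = a \<or> Im z = b}"
  using assms unfolding frontier_def interior_open[OF open_horizontal_strip] closure_horizontal_strip[OF assms]
  by (auto simp: horizontal_strip_def)

lemma edge_dist_horizontal_strip:
  assumes z: "z \<in> horizontal_strip a b"
  shows "edge_dist (horizontal_strip a b) z = min (Im z - a) (b - Im z)"
proof (rule antisym)
  have z': "a < Im z" "Im z < b" using z by (auto simp: horizontal_strip_def)
  then have ab: "a < b" by simp
  have dist_vertical: "dist z (Complex (Re z) c) = \<bar>Im z - c\<bar>" for c
    by (simp add: dist_norm cmod_def)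
  have mem: "Complex (Re z) a \<in> frontier (horizontal_strip a b)" "Complex (Re z) b \<in> frontier (horizontal_strip a b)"
    by (simp_all add: frontier_horizontal_strip[OF ab])
  show "edge_dist (horizontal_strip a b) z \<le> min (Im z - a) (b - Im z)"
    using infdist_le[OF mem(1), of z] infdist_le[OF mem(2), of z] z'
    by (simp add: edge_dist_def dist_vertical)
  obtain x where x: "x \<in> frontier (horizontal_strip a b)" "infdist z (frontier (horizontal_strip a b)) = dist z x"
    using infdist_attains_inf[of "frontier (horizontal_strip a b)" z] mem by auto
  have "min (Im z - a) (b - Im z) \<le> \<bar>Im (z - x)\<bar>"
    using x(1) z' by (auto simp: frontier_horizontal_strip[OF ab])
  also have "\<dots> \<le> dist z x" unfolding dist_norm by (rule abs_Im_le_cmod)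
  finally show "min (Im z - a) (b - Im z) \<le> edge_dist (horizontal_strip a b) z"
    by (simp add: edge_dist_def x(2))
qed

section \<open>From the hypotheses on \<open>y\<close> to Hill solutions and limits\<close>

text \<open>Multiplied by \<open>s\<close>, the candidate becomes
  \<open>exp (\<plusminus> y / 2)\<close>, which \<open>(d/dy)\<^sup>2 - 1/4\<close> annihilates;
  hence the Hill operator annihilates the candidate.\<close>

lemma conjugated_op_solution:
  assumes conj: "op_eq_on B (hill_op p)
      (mult_op (\<lambda>z. s z ^ 3) \<circ> op_minus (ddy y ^^ 2) (mult_op (\<lambda>z. 1 / 4)) \<circ> mult_op s)"
    and B: "open B" and y: "y holomorphic_on B" and s: "s holomorphic_on B"
    and nz: "\<And>z. z \<in> B \<Longrightarrow> s z \<noteq> 0" "\<And>z. z \<in> B \<Longrightarrow> deriv y z \<noteq> 0"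
    and \<epsilon>: "\<epsilon> \<in> {1, -1 :: real}" and z: "z \<in> B"
  shows "deriv (deriv (\<lambda>z. exp (of_real \<epsilon> * y z / 2) / s z)) z
    = (1 / 4 + p z / 2) * (exp (of_real \<epsilon> * y z / 2) / s z)"
proof -
  let ?e = "of_real \<epsilon> :: complex"
  define f where "f z = exp (?e * y z / 2) / s z" for z
  define E where "E z = exp (?e * y z / 2)" for z
  have e2: "?e * ?e = 1" using \<epsilon> by auto
  have "f holomorphic_on B"
    unfolding f_def[abs_def] by (intro holomorphic_intros y s nz) auto
  then have eq: "hill_op p f z
      = (mult_op (\<lambda>z. s z ^ 3) \<circ> op_minus (ddy y ^^ 2) (mult_op (\<lambda>z. 1 / 4)) \<circ> mult_op s) f z"
    using conj B z unfolding op_eq_on_def by blast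
  have E': "(E has_field_derivative ?e * deriv y w / 2 * E w) (at w)" if "w \<in> B" for w
    unfolding E_def[abs_def] using holomorphic_derivI[OF y B that]
    by (auto intro!: derivative_eq_intros)
  \<comment> \<open>Stated for any \<open>F\<close> agreeing with a multiple of \<open>E\<close> on
    \<open>B\<close> only, so that it can be applied to its own output.\<close>
  have ddy_E: "ddy y F w = c * ?e / 2 * E w" if "w \<in> B" "\<And>x. x \<in> B \<Longrightarrow> F x = c * E x" for F w c
  proof -
    have "((\<lambda>x. c * E x) has_field_derivative c * (?e * deriv y w / 2 * E w)) (at w)"
      by (intro DERIV_cmult E' that)
    then have "(F has_field_derivative c * (?e * deriv y w / 2 * E w)) (at w)"
      by (rule has_field_derivative_transform_within_open[OF _ B that(1)]) (simp add: that(2))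
    then have "deriv F w = c * (?e * deriv y w / 2 * E w)" by (rule DERIV_imp_deriv)
    then show ?thesis using nz(2)[OF that(1)] by (simp add: ddy_def mult_op_def)
  qed
  have "ddy y (ddy y (mult_op s f)) z = (1 * ?e / 2) * ?e / 2 * E z"
  proof (intro ddy_E z)
    fix x assume "x \<in> B"
    then show "mult_op s f x = 1 * E x" using nz(1) by (simp add: mult_op_def f_def E_def)
  qed
  also have "\<dots> = 1 / 4 * (s z * f z)"
    using nz(1)[OF z] e2 by (simp add: f_def E_def mult.assoc[symmetric])
  finally have "hill_op p f z = 0"
    unfolding eq by (simp add: op_minus_def mult_op_def numeral_2_eq_2)
  then show ?thesis
    by (simp add: hill_op_def op_minus_def mult_op_def numeral_2_eq_2 f_def[abs_def])
qed

lemma extension_tendsto: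
  assumes Y: "embedding_map (top_of_set (ext_closure B)) euclidean Y"
    and ext: "\<And>z. z \<in> B \<Longrightarrow> Y (Fin z) = Fin (y z)"
    and fixed: "Y MInf = MInf" "Y PInf = PInf" "MInf \<in> ext_closure B" "PInf \<in> ext_closure B"
  shows "Fin z \<in> ext_closure B \<Longrightarrow> (y \<longlongrightarrow> coord (Y (Fin z))) (at z within B)"
    and "\<exists>c'. \<forall>z\<in>B. Re z < c' \<longrightarrow> Re (y z) < c"
    and "\<exists>c'. \<forall>z\<in>B. Re z > c' \<longrightarrow> Re (y z) > c"
proof -
  have hom: "homeomorphic_map (top_of_set (ext_closure B)) (subtopology euclidean (Y ` ext_closure B)) Y"
    using Y by (simp add: embedding_map_def)
  have inj: "inj_on Y (ext_closure B)"
    using homeomorphic_imp_injective_map[OF hom] by simp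
  have cont: "continuous_map (top_of_set (ext_closure B)) euclidean Y"
    using homeomorphic_imp_continuous_map[OF hom] by (rule continuous_map_into_fulltopology)
  have nhd: "\<exists>T. open T \<and> v \<in> T \<and> (\<forall>z\<in>B. Fin z \<in> T \<longrightarrow> Fin (y z) \<in> V)"
    if V: "open V" "Y v \<in> V" "v \<in> ext_closure B" for v V
  proof -
    have "openin (top_of_set (ext_closure B)) {x \<in> ext_closure B. Y x \<in> V}"
      using openin_continuous_map_preimage[OF cont, of V] V by simp
    then obtain T where T: "open T" "{x \<in> ext_closure B. Y x \<in> V} = ext_closure B \<inter> T"
      by (auto simp: openin_open)
    have "Fin (y z) \<in> V" if "z \<in> B" "Fin z \<in> T" for z
    proof -
      have "Fin z \<in> ext_closure B"
        using that(1) closure_subset[of "Fin ` B"] by (auto simp: ext_closure_def)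
      with T(2) that(2) have "Y (Fin z) \<in> V" by blast
      then show ?thesis by (simp add: ext that(1))
    qed
    moreover have "v \<in> T" using T(2) V by blast
    ultimately show ?thesis using T(1) by blast
  qed
  show "(y \<longlongrightarrow> coord (Y (Fin z))) (at z within B)" if z: "Fin z \<in> ext_closure B"
  proof (rule topological_tendstoI)
    fix U assume U: "open U" "coord (Y (Fin z)) \<in> U"
    \<comment> \<open>By injectivity: the two infinite values are already taken at the infinite
      points.\<close>
    have "Y (Fin z) \<noteq> MInf" "Y (Fin z) \<noteq> PInf"
      using inj_onD[OF inj, of "Fin z" MInf] inj_onD[OF inj, of "Fin z" PInf] z fixed by auto
    then have "Y (Fin z) \<in> Fin ` U" using U by (cases "Y (Fin z)") auto
    moreover have "open (Fin ` U)" using U by (simp add: open_Fin_image_iff)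
    ultimately obtain T where T: "open T" "Fin z \<in> T" "\<forall>z\<in>B. Fin z \<in> T \<longrightarrow> Fin (y z) \<in> Fin ` U"
      using nhd[OF _ _ z] by blast
    have "open (Fin -` T)" using T(1) by (simp add: open_dbl_ext_def)
    then show "\<forall>\<^sub>F x in at z within B. y x \<in> U"
      using T unfolding eventually_at_topological by (intro exI[of _ "Fin -` T"]) auto
  qed
  show "\<exists>c'. \<forall>z\<in>B. Re z < c' \<longrightarrow> Re (y z) < c"
  proof -
    obtain T where T: "open T" "MInf \<in> T" "\<forall>z\<in>B. Fin z \<in> T \<longrightarrow> Fin (y z) \<in> insert MInf (Fin ` {z. Re z < c})"
      using nhd[OF open_MInf_basis[of c] _ fixed(3)] fixed(1) by auto
    then obtain c' where "Fin ` {z. Re z < c'} \<subseteq> T" by (auto simp: open_dbl_ext_def)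
    with T(3) show ?thesis by (intro exI[of _ c']) auto
  qed
  show "\<exists>c'. \<forall>z\<in>B. Re z > c' \<longrightarrow> Re (y z) > c"
  proof -
    obtain T where T: "open T" "PInf \<in> T" "\<forall>z\<in>B. Fin z \<in> T \<longrightarrow> Fin (y z) \<in> insert PInf (Fin ` {z. Re z > c})"
      using nhd[OF open_PInf_basis[of c] _ fixed(4)] fixed(2) by auto
    then obtain c' where "Fin ` {z. Re z > c'} \<subseteq> T" by (auto simp: open_dbl_ext_def)
    with T(3) show ?thesis by (intro exI[of _ c']) auto
  qed
qed

text \<open>Only the real part of \<open>y\<close> matters for the modulus of the exponential. For
  \<open>\<epsilon> = -1\<close> the path runs to +\<infinity>, where \<open>Re y\<close> is large,
  and the sign in the exponent reverses it.\<close>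

lemma exp_tendsto_zero_of_ends:
  assumes neg: "\<And>c. \<exists>c'. \<forall>z\<in>horizontal_strip a b. Re z < c' \<longrightarrow> Re (y z) < c"
    and pos: "\<And>c. \<exists>c'. \<forall>z\<in>horizontal_strip a b. Re z > c' \<longrightarrow> Re (y z) > c"
    and \<epsilon>: "\<epsilon> \<in> {1, -1 :: real}" and \<eta>: "a < \<eta>" "\<eta> < b"
  shows "((\<lambda>t. exp (of_real \<epsilon> * y (Complex (\<epsilon> * t) \<eta>))) \<longlongrightarrow> 0) at_bot"
proof (rule tendsto_norm_zero_cancel)
  have mem: "Complex t \<eta> \<in> horizontal_strip a b" for t using \<eta> by (simp add: horizontal_strip_def)
  have "filterlim (\<lambda>t. \<epsilon> * Re (y (Complex (\<epsilon> * t) \<eta>))) at_bot at_bot"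
    unfolding filterlim_at_bot_dense
  proof
    fix c :: real
    have "\<exists>N. \<forall>t<N. \<epsilon> * Re (y (Complex (\<epsilon> * t) \<eta>)) < c"
    proof (cases "\<epsilon> = 1")
      case True
      obtain c' where "\<forall>z\<in>horizontal_strip a b. Re z < c' \<longrightarrow> Re (y z) < c" using neg by blast
      with mem True show ?thesis by (intro exI[of _ c']) auto
    next
      case False
      then have \<epsilon>': "\<epsilon> = -1" using \<epsilon> by simp
      obtain c' where c': "\<forall>z\<in>horizontal_strip a b. Re z > c' \<longrightarrow> Re (y z) > - c" using pos by blast
      have "\<epsilon> * Re (y (Complex (\<epsilon> * t) \<eta>)) < c" if "t < - c'" for t
        using c'[rule_format, OF mem[of "- t"]] that \<epsilon>' by simp
      then show ?thesis by blast
    qed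
    then show "\<forall>\<^sub>F t in at_bot. \<epsilon> * Re (y (Complex (\<epsilon> * t) \<eta>)) < c"
      by (simp add: eventually_at_bot_dense)
  qed
  then have "((\<lambda>t. exp (\<epsilon> * Re (y (Complex (\<epsilon> * t) \<eta>)))) \<longlongrightarrow> 0) at_bot"
    by (rule filterlim_compose[OF exp_at_bot])
  then show "((\<lambda>t. norm (exp (of_real \<epsilon> * y (Complex (\<epsilon> * t) \<eta>)))) \<longlongrightarrow> 0) at_bot"
    by simp
qed

theorem theorem2:
  fixes a b M :: real
    and B :: "complex set"
    and p y y_half :: "complex \<Rightarrow> complex"
    and Y :: "dbl_ext \<Rightarrow> dbl_ext"
    and \<mm> \<nn> :: dbl_ext
    and r r' :: complex
    and j :: nat
  assumes B_def: "B = horizontal_strip a b"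
    and height: "b - a \<ge> pi"
    and p_hol: "p holomorphic_on B"
    and M: "0 < M" "M < 1 / 3"
    and p_bound_near: "\<And>z. z \<in> B \<Longrightarrow> edge_dist B z \<le> pi / 2 \<Longrightarrow>
          cmod (p z / 2) < M * (1 / (2 * sin (edge_dist B z)))\<^sup>2"
    and p_bound_far: "\<And>z. z \<in> B \<Longrightarrow> edge_dist B z \<ge> pi / 2 \<Longrightarrow>
          cmod (p z / 2) < M * (1 / 4)"
    and y_conformal: "conformal_map_on y B"
    and Y_embedding: "embedding_map (top_of_set (ext_closure B)) euclidean Y"
    and Y_extends: "\<And>z. z \<in> B \<Longrightarrow> Y (Fin z) = Fin (y z)"
    and Y_fixes: "Y MInf = MInf" "Y PInf = PInf"
    and y_half_hol: "y_half holomorphic_on B"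
    and y_half_sq: "\<And>z. z \<in> B \<Longrightarrow> (y_half z)\<^sup>2 = deriv y z"
    and conjugation: "op_eq_on B (hill_op p)
          (mult_op (\<lambda>z. y_half z ^ 3)
            \<circ> op_minus (ddy y ^^ 2) (mult_op (\<lambda>z. 1 / 4))
            \<circ> mult_op y_half)"
    and points: "\<mm> \<in> ext_closure B - {MInf, PInf}" "\<nn> \<in> ext_closure B - {MInf, PInf}"
    and r_def: "r = coord \<nn> - coord \<mm>"
    and r'_def: "r' = coord (Y \<nn>) - coord (Y \<mm>)"
    and j: "j \<ge> 1" "\<bar>Im r\<bar> \<in> {0..real j * pi}"
  shows "cmod (r' - r) \<le> 2 * M / (1 - M) * (\<bar>Re r\<bar> + 3 / 2 * real j * pi)"
proof -
  have ab: "a < b" using height pi_gt_zero by linarith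
  have B: "open B" by (simp add: B_def open_horizontal_strip)
  have y_hol: "y holomorphic_on B" and y_nz: "\<And>z. z \<in> B \<Longrightarrow> deriv y z \<noteq> 0"
    using y_conformal by (auto simp: conformal_map_on_def)
  have y_half_nz: "y_half z \<noteq> 0" if "z \<in> B" for z
    using y_half_sq[OF that] y_nz[OF that] by auto
  have inf: "MInf \<in> ext_closure B" "PInf \<in> ext_closure B"
    by (simp_all add: B_def ext_closure_horizontal_strip[OF ab])
  have ext: "\<And>z. Fin z \<in> ext_closure B \<Longrightarrow> (y \<longlongrightarrow> coord (Y (Fin z))) (at z within B)"
    "\<And>c. \<exists>c'. \<forall>z\<in>B. Re z < c' \<longrightarrow> Re (y z) < c"
    "\<And>c. \<exists>c'. \<forall>z\<in>B. Re z > c' \<longrightarrow> Re (y z) > c"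
    by (rule extension_tendsto[OF Y_embedding Y_extends Y_fixes inf]; assumption)+
  have dist: "edge_dist B z = min (Im z - a) (b - Im z)" if "z \<in> B" for z
    using that edge_dist_horizontal_strip by (simp add: B_def)

  \<comment> \<open>The smaller root of \<open>k - k\<^sup>2 = M / 4\<close>.\<close>
  define k where "k = (1 - sqrt (1 - M)) / 2"
  have k_sq: "k - k\<^sup>2 = M / 4" using M by (simp add: k_def power2_eq_square field_simps)
  \<comment> \<open>102/125 is a rational just below the square root of 2/3, the infimum of
    \<open>sqrt (1 - M)\<close>; it yields (1 - 102/125) / 2 = 23/250 as the bound on
    \<open>k\<close>.\<close>
  have "sqrt ((102 / 125)\<^sup>2) \<le> sqrt (1 - M)"
    using M by (intro real_sqrt_le_mono) (simp add: power2_eq_square)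
  moreover have "sqrt (1 - M) < 1" using M by simp
  ultimately have k: "0 < k" "k \<le> 23 / 250" by (simp_all add: k_def)

  interpret hill_strip a b k "\<lambda>z. p z / 2" y y_half
  proof
    show "b - a \<ge> pi" "0 < k" "k \<le> 23 / 250" by fact+
    show "k - k\<^sup>2 \<le> 1 / 12" using k_sq M by simp
    show "y holomorphic_on horizontal_strip a b" "y_half holomorphic_on horizontal_strip a b"
      using y_hol y_half_hol by (simp_all add: B_def)
    show "(y_half z)\<^sup>2 = deriv y z" "y_half z \<noteq> 0" if "z \<in> horizontal_strip a b" for z
      using y_half_sq y_half_nz that by (simp_all add: B_def)
    show "deriv (deriv (\<lambda>z. exp (of_real \<epsilon> * y z / 2) / y_half z)) z
        = (1 / 4 + p z / 2) * (exp (of_real \<epsilon> * y z / 2) / y_half z)"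
      if "\<epsilon> \<in> {1, -1}" "z \<in> horizontal_strip a b" for \<epsilon> z
      using that conjugated_op_solution[OF conjugation B y_hol y_half_hol y_half_nz y_nz] by (simp add: B_def)
    show "cmod (p (Complex x (e + \<sigma> * h)) / 2) \<le> (k - k\<^sup>2) / (sin h)\<^sup>2"
      if e: "(e, \<sigma>) \<in> {(a, 1), (b, -1)}" and h: "0 < h" "h \<le> pi / 2" for x e \<sigma> h
    proof -
      have z: "Complex x (e + \<sigma> * h) \<in> B"
        using e h height pi_gt_zero by (auto simp: B_def horizontal_strip_def)
      then have "edge_dist B (Complex x (e + \<sigma> * h)) = h"
        using dist[OF z] e h height by auto
      with p_bound_near[OF z] h have "cmod (p (Complex x (e + \<sigma> * h)) / 2) < M * (1 / (2 * sin h))\<^sup>2"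
        by simp
      also have "\<dots> = (k - k\<^sup>2) / (sin h)\<^sup>2"
        unfolding k_sq by (simp add: power2_eq_square)
      finally show ?thesis by simp
    qed
    show "cmod (p z / 2) \<le> k - k\<^sup>2" if z: "a + pi / 2 \<le> Im z" "Im z \<le> b - pi / 2" for z
    proof -
      have "a < Im z" "Im z < b" using z pi_gt_zero by linarith+
      then have zB: "z \<in> B" by (simp add: B_def horizontal_strip_def)
      then have "edge_dist B z \<ge> pi / 2" using dist[OF zB] z by simp
      from p_bound_far[OF zB this] show ?thesis unfolding k_sq by simp
    qed
    show "((\<lambda>t. exp (of_real \<epsilon> * y (Complex (\<epsilon> * t) \<eta>))) \<longlongrightarrow> 0) at_bot"
      if "\<epsilon> \<in> {1, -1}" "a < \<eta>" "\<eta> < b" for \<epsilon> \<eta>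
      using that ext(2,3) by (intro exp_tendsto_zero_of_ends) (simp_all add: B_def)
  qed

  obtain m n where mn: "\<mm> = Fin m" "\<nn> = Fin n"
    using points by (cases \<mm>; cases \<nn>) auto
  have lim: "z islimpt B" if "Fin z \<in> ext_closure B" for z
    using Fin_mem_ext_closureD[OF that] open_imp_islimpt[OF B] by (auto simp: closure_def)
  have mn_mem: "Fin m \<in> ext_closure B" "Fin n \<in> ext_closure B" using points mn by auto
  have r: "n - m = r" "coord (Y (Fin n)) - coord (Y (Fin m)) = r'"
    using r_def r'_def mn by auto
  have "cmod (r' - r) \<le> pi * (7 * k / (1 - 5 * k)) + 2 * k * (\<bar>Re r\<bar> + \<bar>Im r\<bar>)"
    using displacement_bound[of n m, folded B_def, OF lim lim ext(1) ext(1), OF mn_mem(2,1,2,1)]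
    unfolding r .
  also have "\<dots> \<le> pi * (7 * k / (1 - 5 * k)) + 2 * k * (\<bar>Re r\<bar> + real j * pi)"
    using j k by (intro add_left_mono mult_left_mono) auto
  also have "\<dots> \<le> 2 * M / (1 - M) * (\<bar>Re r\<bar> + 3 / 2 * real j * pi)"
  proof -
    have M_k: "2 * M / (1 - M) = 8 * k * (1 - k) / (1 - 2 * k)\<^sup>2"
    proof -
      have "M = 4 * k * (1 - k)" using k_sq by (simp add: power2_eq_square algebra_simps)
      moreover from this have "1 - M = (1 - 2 * k)\<^sup>2" by (simp add: power2_eq_square algebra_simps)
      ultimately show ?thesis by simp
    qed
    have slope: "2 * k \<le> 2 * M / (1 - M)"
    proof -
      have "2 * k * (1 - 2 * k)\<^sup>2 \<le> 2 * k * 1" using k by (intro mult_left_mono power_le_one) auto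
      also have "2 * k * 1 \<le> 2 * k * (4 * (1 - k))" using k by (intro mult_left_mono) auto
      finally show ?thesis using k unfolding M_k by (simp add: pos_le_divide_eq)
    qed
    \<comment> \<open>Divided by \<open>k\<close> and cleared of denominators, this is nonnegativity
      of a cubic in \<open>k\<close>, checked from \<open>k \<le> 23 / 250\<close>. It collects the
      coefficients of \<open>j * pi\<close>, as \<open>slope\<close> does for the real part.\<close>
    have legs: "7 * k / (1 - 5 * k) + 2 * k \<le> 3 / 2 * (2 * M / (1 - M))"
    proof -
      have "16 * (k * k) \<le> 16 * (k * (23 / 250))" using k by (intro mult_left_mono) auto
      moreover have "40 * (k * k * k) \<ge> 0" using k by simp
      ultimately have "0 \<le> 3 - 26 * k - 16 * (k * k) + 40 * (k * k * k)" using k by linarith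
      then have "(9 - 10 * k) * (1 - 2 * k)\<^sup>2 \<le> 12 * (1 - k) * (1 - 5 * k)"
        by (simp add: power2_eq_square algebra_simps)
      then have "(9 - 10 * k) / (1 - 5 * k) \<le> 12 * (1 - k) / (1 - 2 * k)\<^sup>2"
        using k by (simp add: pos_divide_le_eq pos_le_divide_eq)
      then have "k * ((9 - 10 * k) / (1 - 5 * k)) \<le> k * (12 * (1 - k) / (1 - 2 * k)\<^sup>2)"
        using k by (intro mult_left_mono) auto
      moreover have "7 * k / (1 - 5 * k) + 2 * k = k * ((9 - 10 * k) / (1 - 5 * k))"
        using k by (simp add: field_simps)
      moreover have "k * (12 * (1 - k) / (1 - 2 * k)\<^sup>2) = 3 / 2 * (8 * k * (1 - k) / (1 - 2 * k)\<^sup>2)"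
        by simp
      ultimately show ?thesis unfolding M_k by linarith
    qed
    \<comment> \<open>The two legs cost a fixed amount; \<open>j \<ge> 1\<close> lets it be counted
      as a multiple of \<open>j * pi\<close>.\<close>
    have "pi * (7 * k / (1 - 5 * k)) \<le> real j * pi * (7 * k / (1 - 5 * k))"
      using j k by (intro mult_right_mono) auto
    then have "pi * (7 * k / (1 - 5 * k)) + 2 * k * (\<bar>Re r\<bar> + real j * pi)
        \<le> 2 * k * \<bar>Re r\<bar> + real j * pi * (7 * k / (1 - 5 * k) + 2 * k)"
      by (simp add: algebra_simps)
    also have "\<dots> \<le> 2 * M / (1 - M) * \<bar>Re r\<bar> + real j * pi * (3 / 2 * (2 * M / (1 - M)))"
      by (intro add_mono mult_right_mono mult_left_mono slope legs) auto
    also have "\<dots> = 2 * M / (1 - M) * (\<bar>Re r\<bar> + 3 / 2 * real j * pi)"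
      by (simp only: distrib_left mult_ac)
    finally show ?thesis .
  qed
  finally show ?thesis .
qed

end
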